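(* Let $\mathcal{Q}$ be a small quantaloid. If $\phi$ is a regular $\mathcal{Q}$-distributor, then $\mathcal{K}\phi$ is a (ccd) $\mathcal{Q}$-category. Conversely, every skeletal (ccd) $\mathcal{Q}$-category is isomorphic (as a $\mathcal{Q}$-category) to $\mathcal{K}\phi$ for some regular $\mathcal{Q}$-distributor $\phi$.
   Context: A quantaloid is a category whose hom-sets are complete lattices and whose composition preserves arbitrary joins in each variable; it is small if it has a set of objects. For arrows $f:X\to Y$, $g:Y\to Z$, $h:X\to Z$ the residuals $h\swarrow f:Y\to Z$ and $g\searrow h:X\to Y$ are determined by $g\circ f\le h\iff g\le h\swarrow f\iff f\le g\searrow h$. A (small) $\mathcal{Q}$-category $\mathbb{A}$ consists of a set $\mathbb{A}_0$ of objects, a type map $t:\mathbb{A}_0\to\mathrm{ob}\,\mathcal{Q}$ and hom-arrows $\mathbb{A}(x,y)\in\mathcal{Q}(tx,ty)$ with $1_{tx}\le\mathbb{A}(x,x)$ and $\mathbb{A}(y,z)\circ\mathbb{A}(x,y)\le\mathbb{A}(x,z)$. Its underlying order: $x\le y$ iff $tx=ty$ and $1_{tx}\le\mathbb{A}(x,y)$; $\mathbb{A}$ is skeletal if $x\le y$ and $y\le x$ imply $x=y$. A $\mathcal{Q}$-functor $F:\mathbb{A}\to\mathbb{B}$ is a type-preserving map on objects with $\mathbb{A}(x,y)\le\mathbb{B}(Fx,Fy)$; $\mathcal{Q}$-functors are ordered pointwise by the underlying order, giving a 2-category $\mathcal{Q}\text{-}\mathbf{Cat}$ in which adjunctions are taken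 ($F\dashv G$ iff $1\le GF$ and $FG\le 1$). A $\mathcal{Q}$-distributor $\phi:\mathbb{A}\nrightarrow\mathbb{B}$ assigns to each $(x,y)\in\mathbb{A}_0\times\mathbb{B}_0$ an arrow $\phi(x,y)\in\mathcal{Q}(tx,ty)$ with $\mathbb{B}(y,y')\circ\phi(x,y)\circ\mathbb{A}(x',x)\le\phi(x',y')$. With composition $(\psi\circ\phi)(x,z)=\bigvee_{y}\psi(y,z)\circ\phi(x,y)$, identities $\mathbb{A}:\mathbb{A}\nrightarrow\mathbb{A}$ given by the hom-arrows, and pointwise order, $\mathcal{Q}$-categories and $\mathcal{Q}$-distributors form a quantaloid $\mathcal{Q}\text{-}\mathbf{Dist}$ (with residuals also denoted $\swarrow,\searrow$). A $\mathcal{Q}$-distributor $\phi:\mathbb{A}\nrightarrow\mathbb{B}$ is regular if there is a $\mathcal{Q}$-distributor $\psi:\mathbb{B}\nrightarrow\mathbb{A}$ with $\phi\circ\psi\circ\phi=\phi$. For $X\in\mathrm{ob}\,\mathcal{Q}$ let $\star_X$ be the $\mathcal{Q}$-category with a single object of type $X$ and hom-arrow $1_X$. The presheaf $\mathcal{Q}$-category $\mathcal{P}\mathbb{A}$ has as objects of type $X$ the $\mathcal{Q}$-distributors $\mu:\mathbb{A}\nrightarrow\star_X$, with $\mathcal{P}\mathbb{A}(\mu,\mu')=\mu'\swarrow\mu$. The Yoneda embedding is $\mathsf{Y}_{\mathbb{A}}:\mathbb{A}\to\mathcal{P}\mathbb{A}$, $x\mapsto\mathbb{A}(-,x)$. $\mathbb{A}$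 is complete if $\mathsf{Y}_{\mathbb{A}}$ has a left adjoint $\sup_{\mathbb{A}}:\mathcal{P}\mathbb{A}\to\mathbb{A}$ in $\mathcal{Q}\text{-}\mathbf{Cat}$. $\mathbb{A}$ is (ccd) (constructively completely distributive) if it is complete and $\sup_{\mathbb{A}}$ has a left adjoint in $\mathcal{Q}\text{-}\mathbf{Cat}$. For $\phi:\mathbb{A}\nrightarrow\mathbb{B}$ let $\phi^*:\mathcal{P}\mathbb{B}\to\mathcal{P}\mathbb{A}$, $\lambda\mapsto\lambda\circ\phi$, and $\phi_*:\mathcal{P}\mathbb{A}\to\mathcal{P}\mathbb{B}$, $\mu\mapsto\mu\swarrow\phi$; then $\phi^*\dashv\phi_*$. $\mathcal{K}\phi:=\{\lambda\in\mathcal{P}\mathbb{B}\mid\phi_*\phi^*\lambda=\lambda\}$, regarded as a $\mathcal{Q}$-subcategory of $\mathcal{P}\mathbb{B}$ (with the same hom-arrows). *)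

theory Defs
  imports "HOL-Algebra.Complete_Lattice"
begin

text \<open>
  A small quantaloid is given by its set of objects, its hom-sets as ordered sets, its identities
  and its composition; \<open>qcomp Q X Y Z g f\<close> is the composite of \<open>f : X \<rightarrow> Y\<close> and \<open>g : Y \<rightarrow> Z\<close>.
  All data are indexed by objects, so distinct hom-sets need not be disjoint.
\<close>

record ('o, 'm) quantaloid =
  qob :: "'o set"
  qhom :: "'o \<Rightarrow> 'o \<Rightarrow> 'm gorder"
  qid :: "'o \<Rightarrow> 'm"
  qcomp :: "'o \<Rightarrow> 'o \<Rightarrow> 'o \<Rightarrow> 'm \<Rightarrow> 'm \<Rightarrow> 'm"

locale quantaloid =
  fixes Q :: "('o, 'm) quantaloid"
  assumes hom_complete_lattice:
      "\<lbrakk>X \<in> qob Q; Y \<in> qob Q\<rbrakk> \<Longrightarrow> complete_lattice (qhom Q X Y)"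
    and id_closed: "X \<in> qob Q \<Longrightarrow> qid Q X \<in> carrier (qhom Q X X)"
    and comp_closed:
      "\<lbrakk>X \<in> qob Q; Y \<in> qob Q; Z \<in> qob Q;
        f \<in> carrier (qhom Q X Y); g \<in> carrier (qhom Q Y Z)\<rbrakk>
       \<Longrightarrow> qcomp Q X Y Z g f \<in> carrier (qhom Q X Z)"
    and comp_id_right:
      "\<lbrakk>X \<in> qob Q; Y \<in> qob Q; f \<in> carrier (qhom Q X Y)\<rbrakk>
       \<Longrightarrow> qcomp Q X X Y f (qid Q X) = f"
    and comp_id_left:
      "\<lbrakk>X \<in> qob Q; Y \<in> qob Q; f \<in> carrier (qhom Q X Y)\<rbrakk>
       \<Longrightarrow> qcomp Q X Y Y (qid Q Y) f = f"
    and comp_assoc: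
      "\<lbrakk>X \<in> qob Q; Y \<in> qob Q; Z \<in> qob Q; W \<in> qob Q;
        f \<in> carrier (qhom Q X Y); g \<in> carrier (qhom Q Y Z); h \<in> carrier (qhom Q Z W)\<rbrakk>
       \<Longrightarrow> qcomp Q X Z W h (qcomp Q X Y Z g f) = qcomp Q X Y W (qcomp Q Y Z W h g) f"
    and comp_join_left:
      "\<lbrakk>X \<in> qob Q; Y \<in> qob Q; Z \<in> qob Q;
        f \<in> carrier (qhom Q X Y); G \<subseteq> carrier (qhom Q Y Z)\<rbrakk>
       \<Longrightarrow> qcomp Q X Y Z (\<Squnion>\<^bsub>qhom Q Y Z\<^esub> G) f
           = \<Squnion>\<^bsub>qhom Q X Z\<^esub> ((\<lambda>g. qcomp Q X Y Z g f) ` G)"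
    and comp_join_right:
      "\<lbrakk>X \<in> qob Q; Y \<in> qob Q; Z \<in> qob Q;
        F \<subseteq> carrier (qhom Q X Y); g \<in> carrier (qhom Q Y Z)\<rbrakk>
       \<Longrightarrow> qcomp Q X Y Z g (\<Squnion>\<^bsub>qhom Q X Y\<^esub> F)
           = \<Squnion>\<^bsub>qhom Q X Z\<^esub> ((\<lambda>f. qcomp Q X Y Z g f) ` F)"

record ('x, 'o, 'm) qcategory =
  cob :: "'x set"
  cty :: "'x \<Rightarrow> 'o"
  chom :: "'x \<Rightarrow> 'x \<Rightarrow> 'm"

locale qcategory = quantaloid Q
  for Q :: "('o, 'm) quantaloid" +
  fixes A :: "('x, 'o, 'm) qcategory"
  assumes ty_closed: "x \<in> cob A \<Longrightarrow> cty A x \<in> qob Q"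
    and chom_closed:
      "\<lbrakk>x \<in> cob A; y \<in> cob A\<rbrakk> \<Longrightarrow> chom A x y \<in> carrier (qhom Q (cty A x) (cty A y))"
    and chom_id:
      "x \<in> cob A \<Longrightarrow> qid Q (cty A x) \<sqsubseteq>\<^bsub>qhom Q (cty A x) (cty A x)\<^esub> chom A x x"
    and chom_comp:
      "\<lbrakk>x \<in> cob A; y \<in> cob A; z \<in> cob A\<rbrakk>
       \<Longrightarrow> qcomp Q (cty A x) (cty A y) (cty A z) (chom A y z) (chom A x y)
           \<sqsubseteq>\<^bsub>qhom Q (cty A x) (cty A z)\<^esub> chom A x z"

definition qcat_le ::
  "('o, 'm) quantaloid \<Rightarrow> ('x, 'o, 'm) qcategory \<Rightarrow> 'x \<Rightarrow> 'x \<Rightarrow> bool" where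
  "qcat_le Q A x y \<longleftrightarrow>
     cty A x = cty A y \<and> qid Q (cty A x) \<sqsubseteq>\<^bsub>qhom Q (cty A x) (cty A y)\<^esub> chom A x y"

definition qcat_skeletal :: "('o, 'm) quantaloid \<Rightarrow> ('x, 'o, 'm) qcategory \<Rightarrow> bool" where
  "qcat_skeletal Q A \<longleftrightarrow>
     (\<forall>x\<in>cob A. \<forall>y\<in>cob A. qcat_le Q A x y \<longrightarrow> qcat_le Q A y x \<longrightarrow> x = y)"

definition qfunctor ::
  "('o, 'm) quantaloid \<Rightarrow> ('x, 'o, 'm) qcategory \<Rightarrow> ('y, 'o, 'm) qcategory \<Rightarrow> ('x \<Rightarrow> 'y) \<Rightarrow> bool"
  where
  "qfunctor Q A B F \<longleftrightarrow>
     (\<forall>x\<in>cob A. F x \<in> cob B \<and> cty B (F x) = cty A x) \<and>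
     (\<forall>x\<in>cob A. \<forall>y\<in>cob A. chom A x y \<sqsubseteq>\<^bsub>qhom Q (cty A x) (cty A y)\<^esub> chom B (F x) (F y))"

definition qadjunction ::
  "('o, 'm) quantaloid \<Rightarrow> ('x, 'o, 'm) qcategory \<Rightarrow> ('y, 'o, 'm) qcategory
   \<Rightarrow> ('x \<Rightarrow> 'y) \<Rightarrow> ('y \<Rightarrow> 'x) \<Rightarrow> bool" where
  "qadjunction Q A B F G \<longleftrightarrow>
     qfunctor Q A B F \<and> qfunctor Q B A G \<and>
     (\<forall>x\<in>cob A. qcat_le Q A x (G (F x))) \<and> (\<forall>y\<in>cob B. qcat_le Q B (F (G y)) y)"

definition qcat_iso ::
  "('o, 'm) quantaloid \<Rightarrow> ('x, 'o, 'm) qcategory \<Rightarrow> ('y, 'o, 'm) qcategory \<Rightarrow> bool" where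
  "qcat_iso Q A B \<longleftrightarrow>
     (\<exists>F G. qfunctor Q A B F \<and> qfunctor Q B A G \<and>
            (\<forall>x\<in>cob A. G (F x) = x) \<and> (\<forall>y\<in>cob B. F (G y) = y))"

text \<open>
  Distributors are normalised to be \<open>undefined\<close> off the object sets, so that equality of HOL
  functions is equality of distributors. The two-sided action law is composed in the order
  \<open>B(y,y') \<circ> (\<phi>(x,y) \<circ> A(x',x))\<close>.
\<close>

locale qdistributor = A: qcategory Q A + B: qcategory Q B
  for Q :: "('o, 'm) quantaloid"
    and A :: "('x, 'o, 'm) qcategory" and B :: "('y, 'o, 'm) qcategory" +
  fixes \<phi> :: "'x \<Rightarrow> 'y \<Rightarrow> 'm"
  assumes dist_closed:
      "\<lbrakk>x \<in> cob A; y \<in> cob B\<rbrakk> \<Longrightarrow> \<phi> x y \<in> carrier (qhom Q (cty A x) (cty B y))"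
    and dist_action:
      "\<lbrakk>x \<in> cob A; x' \<in> cob A; y \<in> cob B; y' \<in> cob B\<rbrakk>
       \<Longrightarrow> qcomp Q (cty A x') (cty B y) (cty B y') (chom B y y')
              (qcomp Q (cty A x') (cty A x) (cty B y) (\<phi> x y) (chom A x' x))
           \<sqsubseteq>\<^bsub>qhom Q (cty A x') (cty B y')\<^esub> \<phi> x' y'"
    and dist_undefined: "x \<notin> cob A \<or> y \<notin> cob B \<Longrightarrow> \<phi> x y = undefined"

definition dist_le ::
  "('o, 'm) quantaloid \<Rightarrow> ('x, 'o, 'm) qcategory \<Rightarrow> ('y, 'o, 'm) qcategory
   \<Rightarrow> ('x \<Rightarrow> 'y \<Rightarrow> 'm) \<Rightarrow> ('x \<Rightarrow> 'y \<Rightarrow> 'm) \<Rightarrow> bool" where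
  "dist_le Q A B \<phi> \<psi> \<longleftrightarrow>
     (\<forall>x\<in>cob A. \<forall>y\<in>cob B. \<phi> x y \<sqsubseteq>\<^bsub>qhom Q (cty A x) (cty B y)\<^esub> \<psi> x y)"

text \<open>\<open>dist_comp Q A B C \<psi> \<phi>\<close> is the composite of \<open>\<phi>\<close> from \<open>A\<close> to \<open>B\<close> with \<open>\<psi>\<close> from \<open>B\<close> to \<open>C\<close>.\<close>

definition dist_comp ::
  "('o, 'm) quantaloid \<Rightarrow> ('x, 'o, 'm) qcategory \<Rightarrow> ('y, 'o, 'm) qcategory
   \<Rightarrow> ('z, 'o, 'm) qcategory \<Rightarrow> ('y \<Rightarrow> 'z \<Rightarrow> 'm) \<Rightarrow> ('x \<Rightarrow> 'y \<Rightarrow> 'm) \<Rightarrow> 'x \<Rightarrow> 'z \<Rightarrow> 'm" where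
  "dist_comp Q A B C \<psi> \<phi> =
     (\<lambda>x z. if x \<in> cob A \<and> z \<in> cob C
            then \<Squnion>\<^bsub>qhom Q (cty A x) (cty C z)\<^esub>
                   ((\<lambda>y. qcomp Q (cty A x) (cty B y) (cty C z) (\<psi> y z) (\<phi> x y)) ` cob B)
            else undefined)"

text \<open>
  For \<open>\<phi>\<close> from \<open>A\<close> to \<open>B\<close> and \<open>\<chi>\<close> from \<open>A\<close> to \<open>C\<close>, \<open>dist_residual Q A B C \<chi> \<phi>\<close> is the residual
  \<open>\<chi> \<swarrow> \<phi>\<close> from \<open>B\<close> to \<open>C\<close> in the quantaloid of distributors: the distributor determined by
  \<open>\<psi> \<circ> \<phi> \<le> \<chi> \<longleftrightarrow> \<psi> \<le> \<chi> \<swarrow> \<phi>\<close>.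
\<close>

definition dist_residual ::
  "('o, 'm) quantaloid \<Rightarrow> ('x, 'o, 'm) qcategory \<Rightarrow> ('y, 'o, 'm) qcategory
   \<Rightarrow> ('z, 'o, 'm) qcategory \<Rightarrow> ('x \<Rightarrow> 'z \<Rightarrow> 'm) \<Rightarrow> ('x \<Rightarrow> 'y \<Rightarrow> 'm) \<Rightarrow> 'y \<Rightarrow> 'z \<Rightarrow> 'm" where
  "dist_residual Q A B C \<chi> \<phi> =
     (THE \<rho>. qdistributor Q B C \<rho> \<and>
        (\<forall>\<psi>. qdistributor Q B C \<psi> \<longrightarrow>
           (dist_le Q A C (dist_comp Q A B C \<psi> \<phi>) \<chi> \<longleftrightarrow> dist_le Q B C \<psi> \<rho>)))"

definition regular_distributor ::
  "('o, 'm) quantaloid \<Rightarrow> ('x, 'o, 'm) qcategory \<Rightarrow> ('y, 'o, 'm) qcategory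
   \<Rightarrow> ('x \<Rightarrow> 'y \<Rightarrow> 'm) \<Rightarrow> bool" where
  "regular_distributor Q A B \<phi> \<longleftrightarrow>
     qdistributor Q A B \<phi> \<and>
     (\<exists>\<psi>. qdistributor Q B A \<psi> \<and> dist_comp Q A A B \<phi> (dist_comp Q A B A \<psi> \<phi>) = \<phi>)"

definition star_cat :: "('o, 'm) quantaloid \<Rightarrow> 'o \<Rightarrow> (unit, 'o, 'm) qcategory" where
  "star_cat Q X = \<lparr>cob = {()}, cty = (\<lambda>_. X), chom = (\<lambda>_ _. qid Q X)\<rparr>"

text \<open>
  An object of the presheaf category is a pair \<open>(X, \<mu>)\<close> of its type \<open>X\<close> and a distributor \<open>\<mu>\<close>
  from \<open>A\<close> to \<open>star_cat Q X\<close>. The hom-arrow \<open>\<mu>' \<swarrow> \<mu>\<close> is a distributor between one-object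
  categories, identified with its only component.
\<close>

type_synonym ('x, 'o, 'm) presheaf = "'o \<times> ('x \<Rightarrow> unit \<Rightarrow> 'm)"

definition presheaf_cat ::
  "('o, 'm) quantaloid \<Rightarrow> ('x, 'o, 'm) qcategory
   \<Rightarrow> (('x, 'o, 'm) presheaf, 'o, 'm) qcategory" where
  "presheaf_cat Q A =
     \<lparr>cob = {(X, \<mu>). X \<in> qob Q \<and> qdistributor Q A (star_cat Q X) \<mu>},
      cty = fst,
      chom = (\<lambda>(X, \<mu>) (X', \<mu>').
                dist_residual Q A (star_cat Q X) (star_cat Q X') \<mu>' \<mu> () ())\<rparr>"

definition yoneda :: "('x, 'o, 'm) qcategory \<Rightarrow> 'x \<Rightarrow> ('x, 'o, 'm) presheaf" where
  "yoneda A x = (cty A x, \<lambda>z _. if z \<in> cob A then chom A z x else undefined)"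

definition is_qsup ::
  "('o, 'm) quantaloid \<Rightarrow> ('x, 'o, 'm) qcategory \<Rightarrow> (('x, 'o, 'm) presheaf \<Rightarrow> 'x) \<Rightarrow> bool" where
  "is_qsup Q A S \<longleftrightarrow> qadjunction Q (presheaf_cat Q A) A S (yoneda A)"

definition qcat_complete :: "('o, 'm) quantaloid \<Rightarrow> ('x, 'o, 'm) qcategory \<Rightarrow> bool" where
  "qcat_complete Q A \<longleftrightarrow> (\<exists>S. is_qsup Q A S)"

text \<open>
  The left adjoint of the Yoneda embedding is unique only up to isomorphism; whether it has a left
  adjoint of its own does not depend on the choice.
\<close>

definition qcat_ccd :: "('o, 'm) quantaloid \<Rightarrow> ('x, 'o, 'm) qcategory \<Rightarrow> bool" where
  "qcat_ccd Q A \<longleftrightarrow>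
     qcat_complete Q A \<and>
     (\<exists>S. is_qsup Q A S \<and> (\<exists>T. qadjunction Q A (presheaf_cat Q A) T S))"

text \<open>For \<open>\<phi>\<close> from \<open>A\<close> to \<open>B\<close>, these are \<open>\<phi>\<^sup>* : PB \<rightarrow> PA\<close> and \<open>\<phi>\<^sub>* : PA \<rightarrow> PB\<close>.\<close>

definition dist_upper_star ::
  "('o, 'm) quantaloid \<Rightarrow> ('x, 'o, 'm) qcategory \<Rightarrow> ('y, 'o, 'm) qcategory
   \<Rightarrow> ('x \<Rightarrow> 'y \<Rightarrow> 'm) \<Rightarrow> ('y, 'o, 'm) presheaf \<Rightarrow> ('x, 'o, 'm) presheaf" where
  "dist_upper_star Q A B \<phi> = (\<lambda>(X, \<nu>). (X, dist_comp Q A B (star_cat Q X) \<nu> \<phi>))"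

definition dist_lower_star ::
  "('o, 'm) quantaloid \<Rightarrow> ('x, 'o, 'm) qcategory \<Rightarrow> ('y, 'o, 'm) qcategory
   \<Rightarrow> ('x \<Rightarrow> 'y \<Rightarrow> 'm) \<Rightarrow> ('x, 'o, 'm) presheaf \<Rightarrow> ('y, 'o, 'm) presheaf" where
  "dist_lower_star Q A B \<phi> = (\<lambda>(X, \<mu>). (X, dist_residual Q A B (star_cat Q X) \<mu> \<phi>))"

definition kan_cat ::
  "('o, 'm) quantaloid \<Rightarrow> ('x, 'o, 'm) qcategory \<Rightarrow> ('y, 'o, 'm) qcategory
   \<Rightarrow> ('x \<Rightarrow> 'y \<Rightarrow> 'm) \<Rightarrow> (('y, 'o, 'm) presheaf, 'o, 'm) qcategory" where
  "kan_cat Q A B \<phi> =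
     \<lparr>cob = {\<nu> \<in> cob (presheaf_cat Q B).
               dist_lower_star Q A B \<phi> (dist_upper_star Q A B \<phi> \<nu>) = \<nu>},
      cty = cty (presheaf_cat Q B),
      chom = chom (presheaf_cat Q B)\<rparr>"

end

theory Submission
  imports Defs
begin

text \<open>
  Let \<open>\<phi> \<circ> \<psi> \<circ> \<phi> = \<phi>\<close> and \<open>e = \<psi> \<circ> \<phi>\<close>. The hom-arrows of \<open>\<K>\<phi>\<close> and its suprema can be read off from
  the presheaves \<open>\<phi>\<^sup>*\<lambda>\<close>, which satisfy \<open>\<phi>\<^sup>*\<lambda> \<circ> e = \<phi>\<^sup>*\<lambda>\<close>; each \<open>e(-,x)\<close> is itself \<open>\<phi>\<^sup>*a\<close> for some \<open>a \<in> \<K>\<phi>\<close>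
  (call it \<open>a\<^sub>x\<close>), and \<open>\<lambda> \<mapsto> \<Or>\<^sub>x (\<phi>\<^sup>*\<lambda>)(x) \<circ> \<K>\<phi>(-, a\<^sub>x)\<close> is left adjoint to the supremum.
  Conversely, given adjunctions of \<open>T\<close> to \<open>S = sup\<close> to \<open>Y\<close> on a skeletal \<open>C\<close>, the distributor
  \<open>\<theta>(x,y) = (T y)(x)\<close> satisfies \<open>\<theta>\<^sup>* = T S\<close> and \<open>\<theta>\<^sub>* = Y S\<close>. As \<open>S T = 1\<close>, \<open>\<theta>\<close> is idempotent and
  \<open>\<theta>\<^sub>* \<theta>\<^sup>* = Y S\<close>, whose fixed points are the representable presheaves.
\<close>

section \<open>Arrows of a quantaloid\<close>

context quantaloid
begin

text \<open>Membership of both objects is included, so that a single fact about an arrow supplies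
  all the typing premises of the quantaloid axioms.\<close>

definition arr :: "'o \<Rightarrow> 'o \<Rightarrow> 'm \<Rightarrow> bool" where
  "arr X Y f \<longleftrightarrow> X \<in> qob Q \<and> Y \<in> qob Q \<and> f \<in> carrier (qhom Q X Y)"

text \<open>Membership in the hom-set is built into the order, so that transitivity and monotonicity of
  composition carry no side conditions.\<close>

definition leq :: "'o \<Rightarrow> 'o \<Rightarrow> 'm \<Rightarrow> 'm \<Rightarrow> bool" where
  "leq X Y f g \<longleftrightarrow> arr X Y f \<and> arr X Y g \<and> f \<sqsubseteq>\<^bsub>qhom Q X Y\<^esub> g"

abbreviation join :: "'o \<Rightarrow> 'o \<Rightarrow> ('i \<Rightarrow> 'm) \<Rightarrow> 'i set \<Rightarrow> 'm" where
  "join X Y f I \<equiv> \<Squnion>\<^bsub>qhom Q X Y\<^esub> (f ` I)"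

lemma arr_ob: "arr X Y f \<Longrightarrow> X \<in> qob Q" "arr X Y f \<Longrightarrow> Y \<in> qob Q"
  by (auto simp: arr_def)

lemma leq_arr: "leq X Y f g \<Longrightarrow> arr X Y f" "leq X Y f g \<Longrightarrow> arr X Y g"
  by (auto simp: leq_def)

lemma leq_imp_le: "leq X Y f g \<Longrightarrow> f \<sqsubseteq>\<^bsub>qhom Q X Y\<^esub> g"
  by (simp add: leq_def)

lemma hom_partial_order:
  assumes "X \<in> qob Q" "Y \<in> qob Q"
  shows "partial_order (qhom Q X Y)"
  using hom_complete_lattice[OF assms] by (simp add: complete_lattice_def)

lemma leq_refl: "arr X Y f \<Longrightarrow> leq X Y f f"
  unfolding leq_def arr_def
  by (meson hom_partial_order partial_order_def weak_partial_order.le_refl)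

lemma leq_trans [trans]: "\<lbrakk>leq X Y f g; leq X Y g h\<rbrakk> \<Longrightarrow> leq X Y f h"
  unfolding leq_def arr_def
  by (meson hom_partial_order partial_order_def weak_partial_order.le_trans)

lemma leq_antisym: "\<lbrakk>leq X Y f g; leq X Y g f\<rbrakk> \<Longrightarrow> f = g"
  unfolding leq_def arr_def
  by (meson hom_partial_order partial_order.le_antisym)

text \<open>Residuals, and with them the hom-arrows of presheaves, are known through the arrows that
  lie below them; this rule turns such knowledge into equalities. The companion rule on upper bounds
  does the same for joins.\<close>

lemma leq_eqI:
  assumes "arr X Y f" "arr X Y g" "\<And>q. leq X Y q f \<longleftrightarrow> leq X Y q g"
  shows "f = g"
  using assms leq_antisym leq_refl by blast

lemma leq_eqI_upper:
  assumes "arr X Y f" "arr X Y g" "\<And>h. leq X Y f h \<longleftrightarrow> leq X Y g h"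
  shows "f = g"
  using assms leq_antisym leq_refl by blast

lemma arr_id: "X \<in> qob Q \<Longrightarrow> arr X X (qid Q X)"
  by (simp add: arr_def id_closed)

lemma arr_comp: "\<lbrakk>arr X Y f; arr Y Z g\<rbrakk> \<Longrightarrow> arr X Z (qcomp Q X Y Z g f)"
  by (simp add: arr_def comp_closed)

lemma comp_id [simp]:
  "arr X Y f \<Longrightarrow> qcomp Q X X Y f (qid Q X) = f"
  "arr X Y f \<Longrightarrow> qcomp Q X Y Y (qid Q Y) f = f"
  by (simp_all add: arr_def comp_id_left comp_id_right)

lemma comp_assoc_arr:
  "\<lbrakk>arr X Y f; arr Y Z g; arr Z W h\<rbrakk>
   \<Longrightarrow> qcomp Q X Y W (qcomp Q Y Z W h g) f = qcomp Q X Z W h (qcomp Q X Y Z g f)"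
  by (simp add: arr_def comp_assoc)

section \<open>Joins of indexed families and their composites\<close>

lemma join_iff:
  assumes "X \<in> qob Q" "Y \<in> qob Q" "\<And>i. i \<in> I \<Longrightarrow> arr X Y (f i)"
  shows "leq X Y (join X Y f I) g \<longleftrightarrow> arr X Y g \<and> (\<forall>i\<in>I. leq X Y (f i) g)"
    and "arr X Y (join X Y f I)"
    and "i \<in> I \<Longrightarrow> leq X Y (f i) (join X Y f I)"
proof -
  interpret complete_lattice "qhom Q X Y" by (rule hom_complete_lattice[OF assms(1,2)])
  have sub: "f ` I \<subseteq> carrier (qhom Q X Y)" using assms by (auto simp: arr_def)
  show arr: "arr X Y (join X Y f I)" using assms(1,2) sub by (simp add: arr_def)
  have upper: "leq X Y (f i) (join X Y f I)" if "i \<in> I" for i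
    using that arr assms(3) sub sup_upper[OF sub] by (auto simp: leq_def)
  then show "i \<in> I \<Longrightarrow> leq X Y (f i) (join X Y f I)" .
  show "leq X Y (join X Y f I) g \<longleftrightarrow> arr X Y g \<and> (\<forall>i\<in>I. leq X Y (f i) g)"
  proof
    assume "arr X Y g \<and> (\<forall>i\<in>I. leq X Y (f i) g)"
    then show "leq X Y (join X Y f I) g"
      using arr sup_least[OF sub, of g] by (auto simp: leq_def arr_def)
  qed (use upper leq_trans leq_arr in blast)
qed

lemmas arr_join = join_iff(2) and leq_join = join_iff(3)

lemma comp_join:
  assumes "\<And>i. i \<in> I \<Longrightarrow> arr X Y (f i)" "arr Y Z g" "X \<in> qob Q"
  shows "qcomp Q X Y Z g (join X Y f I) = join X Z (\<lambda>i. qcomp Q X Y Z g (f i)) I"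
proof -
  have "f ` I \<subseteq> carrier (qhom Q X Y)" using assms by (auto simp: arr_def)
  then show ?thesis
    using comp_join_right[of X Y Z "f ` I" g] assms(2,3) by (auto simp: arr_def image_image)
qed

lemma join_comp:
  assumes "arr X Y f" "\<And>i. i \<in> I \<Longrightarrow> arr Y Z (g i)" "Z \<in> qob Q"
  shows "qcomp Q X Y Z (join Y Z g I) f = join X Z (\<lambda>i. qcomp Q X Y Z (g i) f) I"
proof -
  have "g ` I \<subseteq> carrier (qhom Q Y Z)" using assms by (auto simp: arr_def)
  then show ?thesis
    using comp_join_left[of X Y Z f "g ` I"] assms(1,3) by (auto simp: arr_def image_image)
qed

text \<open>Composition preserves the join, so a bound on the composite is a bound on each member.
  Most later inequalities about joins are reduced to their members in this way. The conjunct
  \<open>arr X Z h\<close> carries the content when \<open>I\<close> is empty.\<close>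

lemma comp_join_iff:
  assumes "\<And>i. i \<in> I \<Longrightarrow> arr X Y (f i)" "arr Y Z g" "X \<in> qob Q"
  shows "leq X Z (qcomp Q X Y Z g (join X Y f I)) h \<longleftrightarrow>
    arr X Z h \<and> (\<forall>i\<in>I. leq X Z (qcomp Q X Y Z g (f i)) h)"
  using join_iff(1)[of X Z I "\<lambda>i. qcomp Q X Y Z g (f i)" h] arr_comp[OF assms(1,2)]
    arr_ob(2)[OF assms(2)] assms(3) comp_join[of I X Y f Z g] assms by simp

lemma join_comp_iff:
  assumes "arr X Y f" "\<And>i. i \<in> I \<Longrightarrow> arr Y Z (g i)" "Z \<in> qob Q"
  shows "leq X Z (qcomp Q X Y Z (join Y Z g I) f) h \<longleftrightarrow>
    arr X Z h \<and> (\<forall>i\<in>I. leq X Z (qcomp Q X Y Z (g i) f) h)"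
  using join_iff(1)[of X Z I "\<lambda>i. qcomp Q X Y Z (g i) f" h] arr_comp[OF assms(1,2)]
    arr_ob(1)[OF assms(1)] join_comp[of X Y f I Z g] assms by simp

text \<open>A two-element join written as a family over \<open>bool\<close>, the form in which
  preservation of joins can be applied to a comparable pair.\<close>

lemma join_pair:
  assumes "leq X Y f g"
  shows "join X Y (\<lambda>b. if b then g else f) UNIV = g"
proof (rule leq_antisym)
  have a: "\<And>b. b \<in> UNIV \<Longrightarrow> arr X Y (if b then g else f)" "X \<in> qob Q" "Y \<in> qob Q"
    using leq_arr[OF assms] arr_ob by auto
  show "leq X Y (join X Y (\<lambda>b. if b then g else f) UNIV) g"
    by (subst join_iff(1)[OF a(2,3,1)]) (use assms leq_arr leq_refl in auto)
  show "leq X Y g (join X Y (\<lambda>b. if b then g else f) UNIV)"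
    using leq_join[where f="\<lambda>b. if b then g else f" and I=UNIV and i=True, OF a(2,3,1)]
    by (simp only: UNIV_I if_True simp_thms)
qed

text \<open>Monotonicity is derived from preservation of joins: if \<open>f \<le> f'\<close> then
  \<open>f'\<close> is the join of the pair, so \<open>g \<circ> f'\<close> is a join with
  \<open>g \<circ> f\<close> among its members. The same argument in the other variable and
  transitivity finish.\<close>

lemma comp_mono:
  assumes "leq X Y f f'" "leq Y Z g g'"
  shows "leq X Z (qcomp Q X Y Z g f) (qcomp Q X Y Z g' f')"
proof -
  note arrs = leq_arr[OF assms(1)] leq_arr[OF assms(2)]
  have fs: "\<And>b. b \<in> UNIV \<Longrightarrow> arr X Y (if b then f' else f)"
    and gs: "\<And>b. b \<in> UNIV \<Longrightarrow> arr Y Z (if b then g' else g)"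
    using arrs by auto
  have ob: "X \<in> qob Q" "Z \<in> qob Q" using arrs arr_ob by blast+
  have 1: "leq X Z (qcomp Q X Y Z g f) (qcomp Q X Y Z g f')"
  proof -
    have "qcomp Q X Y Z g f' = join X Z (\<lambda>b. qcomp Q X Y Z g (if b then f' else f)) UNIV"
      by (simp only: comp_join[OF fs arrs(3) ob(1), symmetric] join_pair[OF assms(1)])
    then show ?thesis
      using leq_join[OF ob, of UNIV "\<lambda>b. qcomp Q X Y Z g (if b then f' else f)" False]
        arrs arr_comp by auto
  qed
  have 2: "leq X Z (qcomp Q X Y Z g f') (qcomp Q X Y Z g' f')"
  proof -
    have "qcomp Q X Y Z g' f' = join X Z (\<lambda>b. qcomp Q X Y Z (if b then g' else g) f') UNIV"
      by (simp only: join_comp[OF arrs(2) gs ob(2), symmetric] join_pair[OF assms(2)])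
    then show ?thesis
      using leq_join[OF ob, of UNIV "\<lambda>b. qcomp Q X Y Z (if b then g' else g) f'" False]
        arrs arr_comp by auto
  qed
  show ?thesis using leq_trans[OF 1 2] .
qed

section \<open>Residuals of families of arrows\<close>

text \<open>This is the meet over \<open>i\<close> of the residuals of \<open>h i\<close> along
  \<open>f i\<close>, obtained directly as the join of all candidates \<open>q\<close>. A family is
  needed because a residual of distributors has to satisfy one condition for each object of the
  domain.\<close>

definition resid ::
  "'o \<Rightarrow> 'o \<Rightarrow> 'i set \<Rightarrow> ('i \<Rightarrow> 'o) \<Rightarrow> ('i \<Rightarrow> 'm) \<Rightarrow> ('i \<Rightarrow> 'm) \<Rightarrow> 'm" where
  "resid Y Z I X f h =
     join Y Z (\<lambda>q. q) {q. arr Y Z q \<and> (\<forall>i\<in>I. leq (X i) Z (qcomp Q (X i) Y Z q (f i)) (h i))}"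

text \<open>Composition with \<open>f i\<close> preserves the join of all candidates, so this join
  is itself a candidate and hence the largest one. Monotonicity makes everything below it a
  candidate as well.\<close>

lemma resid:
  assumes "Y \<in> qob Q" "Z \<in> qob Q"
    and "\<And>i. i \<in> I \<Longrightarrow> arr (X i) Y (f i)" "\<And>i. i \<in> I \<Longrightarrow> arr (X i) Z (h i)"
  shows arr_resid: "arr Y Z (resid Y Z I X f h)"
    and leq_resid: "leq Y Z q (resid Y Z I X f h) \<longleftrightarrow>
      arr Y Z q \<and> (\<forall>i\<in>I. leq (X i) Z (qcomp Q (X i) Y Z q (f i)) (h i))"
proof -
  let ?G = "{q. arr Y Z q \<and> (\<forall>i\<in>I. leq (X i) Z (qcomp Q (X i) Y Z q (f i)) (h i))}"
  have G: "\<And>q. q \<in> ?G \<Longrightarrow> arr Y Z q" by simp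
  show arr: "arr Y Z (resid Y Z I X f h)"
    unfolding resid_def by (rule arr_join[OF assms(1,2) G])
  have max: "leq (X i) Z (qcomp Q (X i) Y Z (resid Y Z I X f h) (f i)) (h i)" if i: "i \<in> I" for i
  proof -
    have "qcomp Q (X i) Y Z (resid Y Z I X f h) (f i)
        = join (X i) Z (\<lambda>q. qcomp Q (X i) Y Z q (f i)) ?G"
      unfolding resid_def by (rule join_comp[OF assms(3)[OF i] G assms(2)])
    moreover have "leq (X i) Z \<dots> (h i)"
      using i assms arr_ob arr_comp by (subst join_iff(1)) blast+
    ultimately show ?thesis by simp
  qed
  show "leq Y Z q (resid Y Z I X f h) \<longleftrightarrow>
      arr Y Z q \<and> (\<forall>i\<in>I. leq (X i) Z (qcomp Q (X i) Y Z q (f i)) (h i))"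
  proof
    assume q: "leq Y Z q (resid Y Z I X f h)"
    show "arr Y Z q \<and> (\<forall>i\<in>I. leq (X i) Z (qcomp Q (X i) Y Z q (f i)) (h i))"
      using leq_arr[OF q] leq_trans[OF comp_mono[OF leq_refl[OF assms(3)] q] max] by blast
  next
    assume "arr Y Z q \<and> (\<forall>i\<in>I. leq (X i) Z (qcomp Q (X i) Y Z q (f i)) (h i))"
    then show "leq Y Z q (resid Y Z I X f h)"
      unfolding resid_def using leq_join[OF assms(1,2), where f="\<lambda>q. q" and I="?G"] by auto
  qed
qed

end

section \<open>Categories and adjunctions\<close>

lemma (in qcategory) arr_chom:
  "\<lbrakk>x \<in> cob A; y \<in> cob A\<rbrakk> \<Longrightarrow> arr (cty A x) (cty A y) (chom A x y)"
  by (simp add: arr_def ty_closed chom_closed)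

lemma (in qcategory) leq_chom_id:
  "x \<in> cob A \<Longrightarrow> leq (cty A x) (cty A x) (qid Q (cty A x)) (chom A x x)"
  by (simp add: leq_def arr_id arr_chom ty_closed chom_id)

lemma (in qcategory) leq_chom_comp:
  "\<lbrakk>x \<in> cob A; y \<in> cob A; z \<in> cob A\<rbrakk> \<Longrightarrow>
   leq (cty A x) (cty A z) (qcomp Q (cty A x) (cty A y) (cty A z) (chom A y z) (chom A x y))
     (chom A x z)"
  using arr_chom arr_comp chom_comp by (simp add: leq_def)

lemma (in qcategory) qcat_le_iff:
  assumes "x \<in> cob A" "y \<in> cob A"
  shows "qcat_le Q A x y \<longleftrightarrow>
    cty A x = cty A y \<and> leq (cty A x) (cty A x) (qid Q (cty A x)) (chom A x y)"
  using assms arr_chom[OF assms] arr_id[OF ty_closed[OF assms(1)]]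
  by (auto simp: qcat_le_def leq_def)

text \<open>Compose with \<open>chom A x y\<close>, which lies above the identity, and apply the
  composition law of the category.\<close>

lemma (in qcategory) qcat_le_chom:
  assumes "x \<in> cob A" "y \<in> cob A" "z \<in> cob A" "qcat_le Q A x y"
  shows "leq (cty A x) (cty A z) (chom A y z) (chom A x z)"
    and "leq (cty A z) (cty A x) (chom A z x) (chom A z y)"
proof -
  have t: "cty A y = cty A x" and l: "leq (cty A x) (cty A x) (qid Q (cty A x)) (chom A x y)"
    using assms qcat_le_iff by auto
  show "leq (cty A x) (cty A z) (chom A y z) (chom A x z)"
    using leq_trans[OF comp_mono[OF l leq_refl[OF arr_chom, of y z, unfolded t]]
        leq_chom_comp[of x y z, unfolded t]] arr_chom[of y z] assms t by simp
  show "leq (cty A z) (cty A x) (chom A z x) (chom A z y)"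
    using leq_trans[OF comp_mono[OF leq_refl[OF arr_chom, of z x] l]
        leq_chom_comp[of z x y, unfolded t]] arr_chom[of z x] assms t by simp
qed

text \<open>Taking \<open>z\<close> to be \<open>x\<close> and then \<open>y\<close> places an
  identity below each of the two hom-arrows between \<open>x\<close> and \<open>y\<close>.\<close>

lemma (in qcategory) skeletal_eqI:
  assumes "qcat_skeletal Q A" "x \<in> cob A" "y \<in> cob A" "cty A x = cty A y"
    and "\<And>z. z \<in> cob A \<Longrightarrow> chom A x z = chom A y z"
  shows "x = y"
  using assms leq_chom_id[of x] leq_chom_id[of y]
  by (simp add: qcat_skeletal_def qcat_le_iff)

section \<open>Functors and adjunctions in terms of hom-arrows\<close>

lemma (in quantaloid) qfunctorD:
  assumes "qcategory Q A" "qcategory Q B" "qfunctor Q A B F" "x \<in> cob A"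
  shows "F x \<in> cob B" "cty B (F x) = cty A x"
    and "y \<in> cob A \<Longrightarrow> leq (cty A x) (cty A y) (chom A x y) (chom B (F x) (F y))"
proof -
  interpret A: qcategory Q A by fact
  interpret B: qcategory Q B by fact
  show 1: "F x \<in> cob B" "cty B (F x) = cty A x" using assms(3,4) by (auto simp: qfunctor_def)
  show "leq (cty A x) (cty A y) (chom A x y) (chom B (F x) (F y))" if y: "y \<in> cob A"
  proof -
    have "F y \<in> cob B" "cty B (F y) = cty A y" using assms(3) y by (auto simp: qfunctor_def)
    then show ?thesis
      using 1 A.arr_chom[OF assms(4) y] B.arr_chom[of "F x" "F y"] assms(3,4) y
      by (simp add: leq_def qfunctor_def)
  qed
qed

lemma (in quantaloid) qfunctorI:
  assumes "\<And>x. x \<in> cob A \<Longrightarrow> F x \<in> cob B \<and> cty B (F x) = cty A x"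
    and "\<And>x y. \<lbrakk>x \<in> cob A; y \<in> cob A\<rbrakk> \<Longrightarrow>
      leq (cty A x) (cty A y) (chom A x y) (chom B (F x) (F y))"
  shows "qfunctor Q A B F"
  using assms by (auto simp: qfunctor_def leq_def)

text \<open>Unit and counit arise from the hom equality at \<open>y = F x\<close> and at
  \<open>x = G y\<close>. Functoriality then follows:
  \<open>A(x,y) \<le> A(x,GFy) = B(Fx,Fy)\<close>, and dually for \<open>G\<close>.\<close>

lemma (in quantaloid) qadjunctionI:
  assumes "qcategory Q A" "qcategory Q B"
    and F: "\<And>x. x \<in> cob A \<Longrightarrow> F x \<in> cob B \<and> cty B (F x) = cty A x"
    and G: "\<And>y. y \<in> cob B \<Longrightarrow> G y \<in> cob A \<and> cty A (G y) = cty B y"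
    and hom: "\<And>x y. \<lbrakk>x \<in> cob A; y \<in> cob B\<rbrakk> \<Longrightarrow> chom B (F x) y = chom A x (G y)"
  shows "qadjunction Q A B F G"
proof -
  interpret A: qcategory Q A by fact
  interpret B: qcategory Q B by fact
  have unit: "qcat_le Q A x (G (F x))" if x: "x \<in> cob A" for x
    using B.leq_chom_id[of "F x"] hom[OF x, of "F x"] F[OF x] G[of "F x"] x
    by (simp add: A.qcat_le_iff)
  have counit: "qcat_le Q B (F (G y)) y" if y: "y \<in> cob B" for y
    using A.leq_chom_id[of "G y"] hom[of "G y" y] F[of "G y"] G[OF y] y
    by (simp add: B.qcat_le_iff)
  have "qfunctor Q A B F"
  proof (rule qfunctorI[OF F])
    fix x y assume xy: "x \<in> cob A" "y \<in> cob A"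
    show "leq (cty A x) (cty A y) (chom A x y) (chom B (F x) (F y))"
      using A.qcat_le_chom(2)[of y "G (F y)" x] unit[of y] hom[of x "F y"] F G xy by simp
  qed
  moreover have "qfunctor Q B A G"
  proof (rule qfunctorI[OF G])
    fix x y assume xy: "x \<in> cob B" "y \<in> cob B"
    show "leq (cty B x) (cty B y) (chom B x y) (chom A (G x) (G y))"
      using B.qcat_le_chom(1)[of "F (G x)" x y] counit[of x] hom[of "G x" y] F G xy by simp
  qed
  ultimately show ?thesis using unit counit by (simp add: qadjunction_def)
qed

text \<open>The usual transposition: apply \<open>G\<close> and compose with the unit for one
  inequality, apply \<open>F\<close> and compose with the counit for the other.\<close>

lemma (in quantaloid) qadjunction_chom:
  assumes "qcategory Q A" "qcategory Q B" "qadjunction Q A B F G" "x \<in> cob A" "y \<in> cob B"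
  shows "chom B (F x) y = chom A x (G y)"
proof -
  interpret A: qcategory Q A by fact
  interpret B: qcategory Q B by fact
  have F: "qfunctor Q A B F" and G: "qfunctor Q B A G"
    and unit: "qcat_le Q A x (G (F x))" and counit: "qcat_le Q B (F (G y)) y"
    using assms(3-5) by (auto simp: qadjunction_def)
  note Fx = qfunctorD[OF assms(1,2) F assms(4)] and Gy = qfunctorD[OF assms(2,1) G assms(5)]
  note GFx = qfunctorD[OF assms(2,1) G Fx(1)] and FGy = qfunctorD[OF assms(1,2) F Gy(1)]
  show ?thesis
  proof (rule leq_antisym)
    show "leq (cty A x) (cty B y) (chom B (F x) y) (chom A x (G y))"
      using leq_trans[OF GFx(3)[OF assms(5), unfolded Fx(2)]]
        A.qcat_le_chom(1)[OF assms(4) GFx(1) Gy(1) unit] Gy(2) by simp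
    show "leq (cty A x) (cty B y) (chom A x (G y)) (chom B (F x) y)"
      using leq_trans[OF Fx(3)[OF Gy(1)]]
        B.qcat_le_chom(2)[OF FGy(1) assms(5) Fx(1) counit] Fx(2) Gy(2) FGy(2) by simp
  qed
qed

section \<open>Distributors and presheaves\<close>

context quantaloid
begin

text \<open>The two-sided action law splits into one-sided laws because identities lie below
  \<open>chom A x x\<close> and \<open>chom B y y\<close>; inserting one of these into the two-sided
  law leaves the action on the other side.\<close>

lemma qdistributorD:
  assumes "qdistributor Q A B \<phi>"
  shows "qcategory Q A" "qcategory Q B"
    and "\<lbrakk>x \<in> cob A; y \<in> cob B\<rbrakk> \<Longrightarrow> arr (cty A x) (cty B y) (\<phi> x y)"
    and "\<lbrakk>x \<in> cob A; x' \<in> cob A; y \<in> cob B\<rbrakk> \<Longrightarrow>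
      leq (cty A x') (cty B y) (qcomp Q (cty A x') (cty A x) (cty B y) (\<phi> x y) (chom A x' x))
        (\<phi> x' y)"
    and "\<lbrakk>x \<in> cob A; y \<in> cob B; y' \<in> cob B\<rbrakk> \<Longrightarrow>
      leq (cty A x) (cty B y') (qcomp Q (cty A x) (cty B y) (cty B y') (chom B y y') (\<phi> x y))
        (\<phi> x y')"
    and "x \<notin> cob A \<or> y \<notin> cob B \<Longrightarrow> \<phi> x y = undefined"
proof -
  interpret d: qdistributor Q A B \<phi> by fact
  show "qcategory Q A" "qcategory Q B" by unfold_locales
  show "x \<notin> cob A \<or> y \<notin> cob B \<Longrightarrow> \<phi> x y = undefined" by (rule d.dist_undefined)
  show arr: "arr (cty A x) (cty B y) (\<phi> x y)" if "x \<in> cob A" "y \<in> cob B" for x y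
    using that by (simp add: arr_def d.A.ty_closed d.B.ty_closed d.dist_closed)
  have act: "leq (cty A x') (cty B y')
      (qcomp Q (cty A x') (cty B y) (cty B y') (chom B y y')
        (qcomp Q (cty A x') (cty A x) (cty B y) (\<phi> x y) (chom A x' x))) (\<phi> x' y')"
    if "x \<in> cob A" "x' \<in> cob A" "y \<in> cob B" "y' \<in> cob B" for x x' y y'
    using that d.dist_action[OF that] arr arr_comp d.A.arr_chom d.B.arr_chom
    by (simp add: leq_def)
  show "leq (cty A x') (cty B y)
      (qcomp Q (cty A x') (cty A x) (cty B y) (\<phi> x y) (chom A x' x)) (\<phi> x' y)"
    if "x \<in> cob A" "x' \<in> cob A" "y \<in> cob B"
    using leq_trans[OF comp_mono[OF leq_refl d.B.leq_chom_id[of y]] act[of x x' y y]]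
      that arr arr_comp[OF d.A.arr_chom[of x' x] arr[of x y]] by simp
  show "leq (cty A x) (cty B y')
      (qcomp Q (cty A x) (cty B y) (cty B y') (chom B y y') (\<phi> x y)) (\<phi> x y')"
    if "x \<in> cob A" "y \<in> cob B" "y' \<in> cob B"
    using leq_trans[OF comp_mono[OF comp_mono[OF d.A.leq_chom_id[of x] leq_refl] leq_refl]
        act[of x x y y']] that arr[of x y] d.B.arr_chom[of y y'] by simp
qed

lemma qdistributorI:
  assumes "qcategory Q A" "qcategory Q B"
    and arr: "\<And>x y. \<lbrakk>x \<in> cob A; y \<in> cob B\<rbrakk> \<Longrightarrow> arr (cty A x) (cty B y) (\<phi> x y)"
    and right: "\<And>x x' y. \<lbrakk>x \<in> cob A; x' \<in> cob A; y \<in> cob B\<rbrakk> \<Longrightarrow>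
      leq (cty A x') (cty B y) (qcomp Q (cty A x') (cty A x) (cty B y) (\<phi> x y) (chom A x' x))
        (\<phi> x' y)"
    and left: "\<And>x y y'. \<lbrakk>x \<in> cob A; y \<in> cob B; y' \<in> cob B\<rbrakk> \<Longrightarrow>
      leq (cty A x) (cty B y') (qcomp Q (cty A x) (cty B y) (cty B y') (chom B y y') (\<phi> x y))
        (\<phi> x y')"
    and "\<And>x y. x \<notin> cob A \<or> y \<notin> cob B \<Longrightarrow> \<phi> x y = undefined"
  shows "qdistributor Q A B \<phi>"
proof -
  interpret A: qcategory Q A by fact
  interpret B: qcategory Q B by fact
  show ?thesis
  proof
    fix x y assume "x \<in> cob A" "y \<in> cob B"
    then show "\<phi> x y \<in> carrier (qhom Q (cty A x) (cty B y))" using arr by (auto simp: arr_def)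
  next
    fix x x' y y' assume xy: "x \<in> cob A" "x' \<in> cob A" "y \<in> cob B" "y' \<in> cob B"
    show "qcomp Q (cty A x') (cty B y) (cty B y') (chom B y y')
        (qcomp Q (cty A x') (cty A x) (cty B y) (\<phi> x y) (chom A x' x))
      \<sqsubseteq>\<^bsub>qhom Q (cty A x') (cty B y')\<^esub> \<phi> x' y'"
      using leq_trans[OF comp_mono[OF right leq_refl[OF B.arr_chom]] left] xy
      by (blast intro: leq_imp_le)
  qed fact
qed

lemma star_cat_simps [simp]:
  "cob (star_cat Q X) = {()}" "cty (star_cat Q X) u = X" "chom (star_cat Q X) u v = qid Q X"
  by (auto simp: star_cat_def)

lemma star_qcategory:
  assumes "X \<in> qob Q"
  shows "qcategory Q (star_cat Q X)"
proof
  show "qid Q (cty (star_cat Q X) x) \<sqsubseteq>\<^bsub>qhom Q (cty (star_cat Q X) x) (cty (star_cat Q X) x)\<^esub>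
      chom (star_cat Q X) x x" for x
    using leq_refl[OF arr_id] assms by (auto intro: leq_imp_le)
  show "qcomp Q (cty (star_cat Q X) x) (cty (star_cat Q X) y) (cty (star_cat Q X) z)
      (chom (star_cat Q X) y z) (chom (star_cat Q X) x y)
    \<sqsubseteq>\<^bsub>qhom Q (cty (star_cat Q X) x) (cty (star_cat Q X) z)\<^esub> chom (star_cat Q X) x z" for x y z
    using leq_refl[OF arr_id] assms arr_id by (auto intro: leq_imp_le)
qed (use assms id_closed in auto)

section \<open>Composition of distributors\<close>

lemma dist_comp_apply:
  "\<lbrakk>x \<in> cob A; z \<in> cob C\<rbrakk> \<Longrightarrow> dist_comp Q A B C \<psi> \<phi> x z =
    join (cty A x) (cty C z) (\<lambda>y. qcomp Q (cty A x) (cty B y) (cty C z) (\<psi> y z) (\<phi> x y)) (cob B)"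
  by (simp add: dist_comp_def)

text \<open>The universal property of the join over the middle objects, also in the forms where a
  further arrow is composed on either side of it.\<close>

lemma dist_comp:
  assumes "qdistributor Q A B \<phi>" "qdistributor Q B C \<psi>" "x \<in> cob A" "z \<in> cob C"
  shows arr_dist_comp: "arr (cty A x) (cty C z) (dist_comp Q A B C \<psi> \<phi> x z)"
    and dist_comp_leq: "leq (cty A x) (cty C z) (dist_comp Q A B C \<psi> \<phi> x z) h \<longleftrightarrow>
      arr (cty A x) (cty C z) h \<and>
      (\<forall>y\<in>cob B. leq (cty A x) (cty C z)
        (qcomp Q (cty A x) (cty B y) (cty C z) (\<psi> y z) (\<phi> x y)) h)"
    and leq_dist_comp: "y \<in> cob B \<Longrightarrow> leq (cty A x) (cty C z)
      (qcomp Q (cty A x) (cty B y) (cty C z) (\<psi> y z) (\<phi> x y)) (dist_comp Q A B C \<psi> \<phi> x z)"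
    and comp_dist_comp_leq: "arr (cty C z) W g \<Longrightarrow>
      leq (cty A x) W (qcomp Q (cty A x) (cty C z) W g (dist_comp Q A B C \<psi> \<phi> x z)) h \<longleftrightarrow>
      arr (cty A x) W h \<and>
      (\<forall>y\<in>cob B. leq (cty A x) W (qcomp Q (cty A x) (cty C z) W g
        (qcomp Q (cty A x) (cty B y) (cty C z) (\<psi> y z) (\<phi> x y))) h)"
    and dist_comp_comp_leq: "arr W (cty A x) f \<Longrightarrow>
      leq W (cty C z) (qcomp Q W (cty A x) (cty C z) (dist_comp Q A B C \<psi> \<phi> x z) f) h \<longleftrightarrow>
      arr W (cty C z) h \<and>
      (\<forall>y\<in>cob B. leq W (cty C z) (qcomp Q W (cty A x) (cty C z)
        (qcomp Q (cty A x) (cty B y) (cty C z) (\<psi> y z) (\<phi> x y)) f) h)"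
proof -
  note d = qdistributorD(3)[OF assms(1), OF assms(3)] qdistributorD(3)[OF assms(2), OF _ assms(4)]
  have ob: "cty A x \<in> qob Q" "cty C z \<in> qob Q"
    using qdistributorD(1)[OF assms(1)] qdistributorD(2)[OF assms(2)] assms(3,4)
      qcategory.ty_closed by fast+
  have a: "\<And>y. y \<in> cob B \<Longrightarrow> arr (cty A x) (cty C z)
      (qcomp Q (cty A x) (cty B y) (cty C z) (\<psi> y z) (\<phi> x y))"
    using d arr_comp by blast
  note eq = dist_comp_apply[OF assms(3,4)]
  show "arr (cty A x) (cty C z) (dist_comp Q A B C \<psi> \<phi> x z)"
    unfolding eq by (rule arr_join[OF ob a])
  show "leq (cty A x) (cty C z) (dist_comp Q A B C \<psi> \<phi> x z) h \<longleftrightarrow>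
      arr (cty A x) (cty C z) h \<and> (\<forall>y\<in>cob B. leq (cty A x) (cty C z)
        (qcomp Q (cty A x) (cty B y) (cty C z) (\<psi> y z) (\<phi> x y)) h)"
    unfolding eq by (rule join_iff(1)[OF ob a])
  show "y \<in> cob B \<Longrightarrow> leq (cty A x) (cty C z)
      (qcomp Q (cty A x) (cty B y) (cty C z) (\<psi> y z) (\<phi> x y)) (dist_comp Q A B C \<psi> \<phi> x z)"
    unfolding eq by (rule leq_join[OF ob a])
  show "arr (cty C z) W g \<Longrightarrow>
      leq (cty A x) W (qcomp Q (cty A x) (cty C z) W g (dist_comp Q A B C \<psi> \<phi> x z)) h \<longleftrightarrow>
      arr (cty A x) W h \<and>
      (\<forall>y\<in>cob B. leq (cty A x) W (qcomp Q (cty A x) (cty C z) W g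
        (qcomp Q (cty A x) (cty B y) (cty C z) (\<psi> y z) (\<phi> x y))) h)"
    unfolding eq by (rule comp_join_iff[OF a _ ob(1)])
  show "arr W (cty A x) f \<Longrightarrow>
      leq W (cty C z) (qcomp Q W (cty A x) (cty C z) (dist_comp Q A B C \<psi> \<phi> x z) f) h \<longleftrightarrow>
      arr W (cty C z) h \<and>
      (\<forall>y\<in>cob B. leq W (cty C z) (qcomp Q W (cty A x) (cty C z)
        (qcomp Q (cty A x) (cty B y) (cty C z) (\<psi> y z) (\<phi> x y)) f) h)"
    unfolding eq by (rule join_comp_iff[OF _ a ob(2)])
qed

text \<open>Each action reaches, after reassociation, the factor next to it and is absorbed
  there.\<close>

lemma qdistributor_dist_comp:
  assumes "qdistributor Q A B \<phi>" "qdistributor Q B C \<psi>"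
  shows "qdistributor Q A C (dist_comp Q A B C \<psi> \<phi>)"
proof -
  note dA = qdistributorD[OF assms(1)] and dC = qdistributorD[OF assms(2)]
  interpret A: qcategory Q A by fact
  interpret C: qcategory Q C by (rule dC)
  show ?thesis
  proof (rule qdistributorI[OF dA(1) dC(2)])
    fix x x' z assume h: "x \<in> cob A" "x' \<in> cob A" "z \<in> cob C"
    show "leq (cty A x') (cty C z) (qcomp Q (cty A x') (cty A x) (cty C z)
        (dist_comp Q A B C \<psi> \<phi> x z) (chom A x' x)) (dist_comp Q A B C \<psi> \<phi> x' z)"
      unfolding dist_comp_comp_leq[OF assms h(1,3) A.arr_chom[OF h(2,1)]]
    proof (intro conjI ballI)
      show "arr (cty A x') (cty C z) (dist_comp Q A B C \<psi> \<phi> x' z)"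
        by (rule arr_dist_comp[OF assms h(2,3)])
      fix y assume y: "y \<in> cob B"
      show "leq (cty A x') (cty C z) (qcomp Q (cty A x') (cty A x) (cty C z)
          (qcomp Q (cty A x) (cty B y) (cty C z) (\<psi> y z) (\<phi> x y)) (chom A x' x))
        (dist_comp Q A B C \<psi> \<phi> x' z)"
        using leq_trans[OF comp_mono[OF dA(4)[OF h(1,2) y] leq_refl[OF dC(3)[OF y h(3)]]]
            leq_dist_comp[OF assms h(2,3) y]]
          comp_assoc_arr[OF A.arr_chom[OF h(2,1)] dA(3)[OF h(1) y] dC(3)[OF y h(3)]] by simp
    qed
  next
    fix x z z' assume h: "x \<in> cob A" "z \<in> cob C" "z' \<in> cob C"
    show "leq (cty A x) (cty C z') (qcomp Q (cty A x) (cty C z) (cty C z')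
        (chom C z z') (dist_comp Q A B C \<psi> \<phi> x z)) (dist_comp Q A B C \<psi> \<phi> x z')"
      unfolding comp_dist_comp_leq[OF assms h(1,2) C.arr_chom[OF h(2,3)]]
    proof (intro conjI ballI)
      show "arr (cty A x) (cty C z') (dist_comp Q A B C \<psi> \<phi> x z')"
        by (rule arr_dist_comp[OF assms h(1,3)])
      fix y assume y: "y \<in> cob B"
      show "leq (cty A x) (cty C z') (qcomp Q (cty A x) (cty C z) (cty C z') (chom C z z')
          (qcomp Q (cty A x) (cty B y) (cty C z) (\<psi> y z) (\<phi> x y)))
        (dist_comp Q A B C \<psi> \<phi> x z')"
        using leq_trans[OF comp_mono[OF leq_refl[OF dA(3)[OF h(1) y]] dC(5)[OF y h(2,3)]]
            leq_dist_comp[OF assms h(1,3) y]]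
          comp_assoc_arr[OF dA(3)[OF h(1) y] dC(3)[OF y h(2)] C.arr_chom[OF h(2,3)]] by simp
    qed
  qed (use arr_dist_comp[OF assms] in \<open>auto simp: dist_comp_def\<close>)
qed

text \<open>Both sides are double joins of the same triple composites. Each inequality is reduced to
  single triples by the universal properties, so the joins never have to be interchanged
  explicitly.\<close>

lemma dist_comp_assoc:
  assumes "qdistributor Q A B \<phi>" "qdistributor Q B C \<psi>" "qdistributor Q C D \<chi>"
  shows "dist_comp Q A C D \<chi> (dist_comp Q A B C \<psi> \<phi>) = dist_comp Q A B D (dist_comp Q B C D \<chi> \<psi>) \<phi>"
proof (intro ext)
  fix x w
  note d1 = qdistributorD[OF assms(1)] and d2 = qdistributorD[OF assms(2)]
    and d3 = qdistributorD[OF assms(3)]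
  note c1 = qdistributor_dist_comp[OF assms(1,2)] and c2 = qdistributor_dist_comp[OF assms(2,3)]
  show "dist_comp Q A C D \<chi> (dist_comp Q A B C \<psi> \<phi>) x w
      = dist_comp Q A B D (dist_comp Q B C D \<chi> \<psi>) \<phi> x w"
  proof (cases "x \<in> cob A \<and> w \<in> cob D")
    case True
    then have h: "x \<in> cob A" "w \<in> cob D" by auto
    show ?thesis
    proof (rule leq_antisym)
      show "leq (cty A x) (cty D w) (dist_comp Q A C D \<chi> (dist_comp Q A B C \<psi> \<phi>) x w)
          (dist_comp Q A B D (dist_comp Q B C D \<chi> \<psi>) \<phi> x w)"
        unfolding dist_comp_leq[OF c1 assms(3) h]
      proof (intro conjI ballI)
        fix z assume z: "z \<in> cob C"
        show "leq (cty A x) (cty D w) (qcomp Q (cty A x) (cty C z) (cty D w) (\<chi> z w)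
            (dist_comp Q A B C \<psi> \<phi> x z)) (dist_comp Q A B D (dist_comp Q B C D \<chi> \<psi>) \<phi> x w)"
          unfolding comp_dist_comp_leq[OF assms(1,2) h(1) z d3(3)[OF z h(2)]]
        proof (intro conjI ballI)
          fix y assume y: "y \<in> cob B"
          show "leq (cty A x) (cty D w) (qcomp Q (cty A x) (cty C z) (cty D w) (\<chi> z w)
              (qcomp Q (cty A x) (cty B y) (cty C z) (\<psi> y z) (\<phi> x y)))
            (dist_comp Q A B D (dist_comp Q B C D \<chi> \<psi>) \<phi> x w)"
            unfolding comp_assoc_arr[OF d1(3)[OF h(1) y] d2(3)[OF y z] d3(3)[OF z h(2)], symmetric]
            by (rule leq_trans[OF comp_mono[OF leq_refl[OF d1(3)[OF h(1) y]]
                    leq_dist_comp[OF assms(2,3) y h(2) z]] leq_dist_comp[OF assms(1) c2 h y]])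
        qed (rule arr_dist_comp[OF assms(1) c2 h])
      qed (rule arr_dist_comp[OF assms(1) c2 h])
      show "leq (cty A x) (cty D w) (dist_comp Q A B D (dist_comp Q B C D \<chi> \<psi>) \<phi> x w)
          (dist_comp Q A C D \<chi> (dist_comp Q A B C \<psi> \<phi>) x w)"
        unfolding dist_comp_leq[OF assms(1) c2 h]
      proof (intro conjI ballI)
        fix y assume y: "y \<in> cob B"
        show "leq (cty A x) (cty D w) (qcomp Q (cty A x) (cty B y) (cty D w)
            (dist_comp Q B C D \<chi> \<psi> y w) (\<phi> x y))
            (dist_comp Q A C D \<chi> (dist_comp Q A B C \<psi> \<phi>) x w)"
          unfolding dist_comp_comp_leq[OF assms(2,3) y h(2) d1(3)[OF h(1) y]]
        proof (intro conjI ballI)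
          fix z assume z: "z \<in> cob C"
          show "leq (cty A x) (cty D w) (qcomp Q (cty A x) (cty B y) (cty D w)
              (qcomp Q (cty B y) (cty C z) (cty D w) (\<chi> z w) (\<psi> y z)) (\<phi> x y))
            (dist_comp Q A C D \<chi> (dist_comp Q A B C \<psi> \<phi>) x w)"
            unfolding comp_assoc_arr[OF d1(3)[OF h(1) y] d2(3)[OF y z] d3(3)[OF z h(2)]]
            by (rule leq_trans[OF comp_mono[OF leq_dist_comp[OF assms(1,2) h(1) z y]
                    leq_refl[OF d3(3)[OF z h(2)]]] leq_dist_comp[OF c1 assms(3) h z]])
        qed (rule arr_dist_comp[OF c1 assms(3) h])
      qed (rule arr_dist_comp[OF c1 assms(3) h])
    qed
  qed (auto simp: dist_comp_def)
qed

section \<open>Residuals of distributors\<close>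

text \<open>The residual is described by testing against whole distributors, whereas later arguments
  need it at one pair of objects and for a single arrow \<open>q\<close>. The pointwise residual
  provides this, is itself a distributor, and therefore is the one that the description picks
  out.\<close>

lemma dist_residual:
  assumes \<phi>: "qdistributor Q A B \<phi>" and \<chi>: "qdistributor Q A C \<chi>"
  shows qdistributor_dist_residual: "qdistributor Q B C (dist_residual Q A B C \<chi> \<phi>)"
    and leq_dist_residual: "\<lbrakk>b \<in> cob B; c \<in> cob C\<rbrakk> \<Longrightarrow>
      leq (cty B b) (cty C c) q (dist_residual Q A B C \<chi> \<phi> b c) \<longleftrightarrow>
      arr (cty B b) (cty C c) q \<and>
      (\<forall>x\<in>cob A. leq (cty A x) (cty C c) (qcomp Q (cty A x) (cty B b) (cty C c) q (\<phi> x b)) (\<chi> x c))"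
proof -
  note dB = qdistributorD[OF \<phi>] and dC = qdistributorD[OF \<chi>]
  interpret B: qcategory Q B by (rule dB)
  interpret C: qcategory Q C by (rule dC)
  \<comment> \<open>The pointwise residual, set to \<open>undefined\<close> off the objects to match
    the normalisation of distributors.\<close>
  define \<rho> where "\<rho> = (\<lambda>b c. if b \<in> cob B \<and> c \<in> cob C
    then resid (cty B b) (cty C c) (cob A) (cty A) (\<lambda>x. \<phi> x b) (\<lambda>x. \<chi> x c) else undefined)"
  have leq: "leq (cty B b) (cty C c) q (\<rho> b c) \<longleftrightarrow> arr (cty B b) (cty C c) q \<and>
      (\<forall>x\<in>cob A. leq (cty A x) (cty C c) (qcomp Q (cty A x) (cty B b) (cty C c) q (\<phi> x b)) (\<chi> x c))"
    if "b \<in> cob B" "c \<in> cob C" for b c q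
    using that dB(3) dC(3) B.ty_closed C.ty_closed by (simp add: \<rho>_def leq_resid)
  have arr: "arr (cty B b) (cty C c) (\<rho> b c)" if "b \<in> cob B" "c \<in> cob C" for b c
    using that dB(3) dC(3) B.ty_closed C.ty_closed by (simp add: \<rho>_def arr_resid)
  have max: "leq (cty A x) (cty C c) (qcomp Q (cty A x) (cty B b) (cty C c) (\<rho> b c) (\<phi> x b)) (\<chi> x c)"
    if "b \<in> cob B" "c \<in> cob C" "x \<in> cob A" for b c x
    using leq[of b c] leq_refl[OF arr] that by blast
  have dist: "qdistributor Q B C \<rho>"
  proof (rule qdistributorI[OF dB(2) dC(2) arr])
    fix b b' c assume h: "b \<in> cob B" "b' \<in> cob B" "c \<in> cob C"
    show "leq (cty B b') (cty C c)
        (qcomp Q (cty B b') (cty B b) (cty C c) (\<rho> b c) (chom B b' b)) (\<rho> b' c)"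
      unfolding leq[OF h(2,3)]
    proof (intro conjI ballI)
      show "arr (cty B b') (cty C c) (qcomp Q (cty B b') (cty B b) (cty C c) (\<rho> b c) (chom B b' b))"
        by (rule arr_comp[OF B.arr_chom[OF h(2,1)] arr[OF h(1,3)]])
      fix x assume x: "x \<in> cob A"
      show "leq (cty A x) (cty C c) (qcomp Q (cty A x) (cty B b') (cty C c)
          (qcomp Q (cty B b') (cty B b) (cty C c) (\<rho> b c) (chom B b' b)) (\<phi> x b')) (\<chi> x c)"
        unfolding comp_assoc_arr[OF dB(3)[OF x h(2)] B.arr_chom[OF h(2,1)] arr[OF h(1,3)]]
        by (rule leq_trans[OF comp_mono[OF dB(5)[OF x h(2,1)] leq_refl[OF arr[OF h(1,3)]]]
              max[OF h(1,3) x]])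
    qed
  next
    fix b c c' assume h: "b \<in> cob B" "c \<in> cob C" "c' \<in> cob C"
    show "leq (cty B b) (cty C c')
        (qcomp Q (cty B b) (cty C c) (cty C c') (chom C c c') (\<rho> b c)) (\<rho> b c')"
      unfolding leq[OF h(1,3)]
    proof (intro conjI ballI)
      show "arr (cty B b) (cty C c') (qcomp Q (cty B b) (cty C c) (cty C c') (chom C c c') (\<rho> b c))"
        by (rule arr_comp[OF arr[OF h(1,2)] C.arr_chom[OF h(2,3)]])
      fix x assume x: "x \<in> cob A"
      show "leq (cty A x) (cty C c') (qcomp Q (cty A x) (cty B b) (cty C c')
          (qcomp Q (cty B b) (cty C c) (cty C c') (chom C c c') (\<rho> b c)) (\<phi> x b)) (\<chi> x c')"
        unfolding comp_assoc_arr[OF dB(3)[OF x h(1)] arr[OF h(1,2)] C.arr_chom[OF h(2,3)]]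
        by (rule leq_trans[OF comp_mono[OF max[OF h(1,2) x] leq_refl[OF C.arr_chom[OF h(2,3)]]]
              dC(5)[OF x h(2,3)]])
    qed
  qed (auto simp: \<rho>_def)
  have dist_le_iff: "dist_le Q B C \<psi> \<psi>' \<longleftrightarrow>
      (\<forall>b\<in>cob B. \<forall>c\<in>cob C. leq (cty B b) (cty C c) (\<psi> b c) (\<psi>' b c))"
    if "qdistributor Q B C \<psi>" "qdistributor Q B C \<psi>'" for \<psi> \<psi>'
    using qdistributorD(3)[OF that(1)] qdistributorD(3)[OF that(2)]
    by (auto simp: dist_le_def leq_def)
  have adj: "dist_le Q A C (dist_comp Q A B C \<psi> \<phi>) \<chi> \<longleftrightarrow> dist_le Q B C \<psi> \<rho>"
    if \<psi>: "qdistributor Q B C \<psi>" for \<psi>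
  proof -
    have "dist_le Q A C (dist_comp Q A B C \<psi> \<phi>) \<chi> \<longleftrightarrow>
        (\<forall>x\<in>cob A. \<forall>c\<in>cob C. leq (cty A x) (cty C c) (dist_comp Q A B C \<psi> \<phi> x c) (\<chi> x c))"
      using arr_dist_comp[OF \<phi> \<psi>] dC(3) by (auto simp: dist_le_def leq_def)
    then show ?thesis
      using dist_comp_leq[OF \<phi> \<psi>] dC(3) leq qdistributorD(3)[OF \<psi>]
      unfolding dist_le_iff[OF \<psi> dist] by blast
  qed
  have "dist_residual Q A B C \<chi> \<phi> = \<rho>"
    unfolding dist_residual_def
  proof (rule the_equality, intro conjI allI impI)
    fix \<sigma> assume \<sigma>: "qdistributor Q B C \<sigma> \<and> (\<forall>\<psi>. qdistributor Q B C \<psi> \<longrightarrow>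
      (dist_le Q A C (dist_comp Q A B C \<psi> \<phi>) \<chi> \<longleftrightarrow> dist_le Q B C \<psi> \<sigma>))"
    then have eq: "dist_le Q B C \<psi> \<sigma> \<longleftrightarrow> dist_le Q B C \<psi> \<rho>" if "qdistributor Q B C \<psi>" for \<psi>
      using that adj by blast
    note s = conjunct1[OF \<sigma>]
    have refl: "dist_le Q B C \<psi> \<psi>" if "qdistributor Q B C \<psi>" for \<psi>
      unfolding dist_le_iff[OF that that] using qdistributorD(3)[OF that] leq_refl by simp
    \<comment> \<open>Uniqueness: each of the two distributors is tested against the universal
      property of the other.\<close>
    have le: "dist_le Q B C \<sigma> \<rho>" "dist_le Q B C \<rho> \<sigma>"
      using eq[OF s] eq[OF dist] refl[OF s] refl[OF dist] by simp_all
    show "\<sigma> = \<rho>"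
    proof (intro ext)
      fix b c
      show "\<sigma> b c = \<rho> b c"
      proof (cases "b \<in> cob B \<and> c \<in> cob C")
        case True
        then show ?thesis
          using le[unfolded dist_le_iff[OF s dist] dist_le_iff[OF dist s]] leq_antisym by blast
      next
        case False
        then show ?thesis using qdistributorD(6)[OF s] qdistributorD(6)[OF dist] by metis
      qed
    qed
  qed (use dist adj in auto)
  then show "qdistributor Q B C (dist_residual Q A B C \<chi> \<phi>)"
    and "\<lbrakk>b \<in> cob B; c \<in> cob C\<rbrakk> \<Longrightarrow>
      leq (cty B b) (cty C c) q (dist_residual Q A B C \<chi> \<phi> b c) \<longleftrightarrow>
      arr (cty B b) (cty C c) q \<and>
      (\<forall>x\<in>cob A. leq (cty A x) (cty C c) (qcomp Q (cty A x) (cty B b) (cty C c) q (\<phi> x b)) (\<chi> x c))"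
    using dist leq by auto
qed

end

section \<open>Presheaves and the presheaf category\<close>

context quantaloid
begin

abbreviation presheaves :: "('x, 'o, 'm) qcategory \<Rightarrow> ('x, 'o, 'm) presheaf set" where
  "presheaves A \<equiv> cob (presheaf_cat Q A)"

abbreviation val :: "('x, 'o, 'm) presheaf \<Rightarrow> 'x \<Rightarrow> 'm" where
  "val p x \<equiv> snd p x ()"

definition mk_presheaf :: "('x, 'o, 'm) qcategory \<Rightarrow> 'o \<Rightarrow> ('x \<Rightarrow> 'm) \<Rightarrow> ('x, 'o, 'm) presheaf" where
  "mk_presheaf A X f = (X, \<lambda>x _. if x \<in> cob A then f x else undefined)"

lemma mk_presheaf_simps [simp]:
  "fst (mk_presheaf A X f) = X" "x \<in> cob A \<Longrightarrow> val (mk_presheaf A X f) x = f x"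
  by (simp_all add: mk_presheaf_def)

lemma yoneda_eq: "yoneda A x = mk_presheaf A (cty A x) (\<lambda>z. chom A z x)"
  by (simp add: yoneda_def mk_presheaf_def)

lemma cty_presheaf_cat [simp]: "cty (presheaf_cat Q A) p = fst p"
  by (simp add: presheaf_cat_def)

lemma presheaf_iff:
  "p \<in> presheaves A \<longleftrightarrow> fst p \<in> qob Q \<and> qdistributor Q A (star_cat Q (fst p)) (snd p)"
  by (auto simp: presheaf_cat_def)

lemma presheafD:
  assumes "p \<in> presheaves A"
  shows "fst p \<in> qob Q" "qdistributor Q A (star_cat Q (fst p)) (snd p)"
    and "x \<in> cob A \<Longrightarrow> arr (cty A x) (fst p) (val p x)"
    and "\<lbrakk>x \<in> cob A; x' \<in> cob A\<rbrakk> \<Longrightarrow>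
      leq (cty A x') (fst p) (qcomp Q (cty A x') (cty A x) (fst p) (val p x) (chom A x' x)) (val p x')"
  using assms qdistributorD(3,4)[of A "star_cat Q (fst p)" "snd p"] by (simp_all add: presheaf_iff)

text \<open>The one-object category acts by an identity, so the action of \<open>A\<close> is all
  that remains to be checked.\<close>

lemma mk_presheaf_in:
  assumes "qcategory Q A" "X \<in> qob Q"
    and "\<And>x. x \<in> cob A \<Longrightarrow> arr (cty A x) X (f x)"
    and "\<And>x x'. \<lbrakk>x \<in> cob A; x' \<in> cob A\<rbrakk> \<Longrightarrow>
      leq (cty A x') X (qcomp Q (cty A x') (cty A x) X (f x) (chom A x' x)) (f x')"
  shows "mk_presheaf A X f \<in> presheaves A"
proof -
  have "qdistributor Q A (star_cat Q X) (\<lambda>x _. if x \<in> cob A then f x else undefined)"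
    by (rule qdistributorI[OF assms(1) star_qcategory[OF assms(2)]])
      (use assms(3,4) leq_refl in auto)
  then show ?thesis using assms(2) by (simp add: presheaf_iff mk_presheaf_def)
qed

lemma presheaf_eqI:
  assumes "p \<in> presheaves A" "p' \<in> presheaves A" "fst p = fst p'"
    and "\<And>x. x \<in> cob A \<Longrightarrow> val p x = val p' x"
  shows "p = p'"
proof (rule prod_eqI[OF assms(3)], intro ext)
  fix x and u :: unit
  show "snd p x u = snd p' x u"
    using assms(4) qdistributorD(6)[OF presheafD(2)[OF assms(1)], of x u]
      qdistributorD(6)[OF presheafD(2)[OF assms(2)], of x u] by (cases "x \<in> cob A") auto
qed

text \<open>The residual of distributors at its single component: the hom-arrow is the largest
  \<open>q\<close> with \<open>q \<circ> p \<le> p'\<close> at every object.\<close>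

lemma presheaf_chom:
  assumes "p \<in> presheaves A" "p' \<in> presheaves A"
  shows arr_presheaf_chom: "arr (fst p) (fst p') (chom (presheaf_cat Q A) p p')"
    and leq_presheaf_chom: "leq (fst p) (fst p') q (chom (presheaf_cat Q A) p p') \<longleftrightarrow>
      arr (fst p) (fst p') q \<and>
      (\<forall>x\<in>cob A. leq (cty A x) (fst p')
        (qcomp Q (cty A x) (fst p) (fst p') q (val p x)) (val p' x))"
proof -
  note d = presheafD(2)[OF assms(1)] presheafD(2)[OF assms(2)]
  have eq: "chom (presheaf_cat Q A) p p' =
      dist_residual Q A (star_cat Q (fst p)) (star_cat Q (fst p')) (snd p') (snd p) () ()"
    by (simp add: presheaf_cat_def split_beta)
  show "arr (fst p) (fst p') (chom (presheaf_cat Q A) p p')"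
    using qdistributorD(3)[OF qdistributor_dist_residual[OF d], of "()" "()"] by (simp add: eq)
  show "leq (fst p) (fst p') q (chom (presheaf_cat Q A) p p') \<longleftrightarrow>
      arr (fst p) (fst p') q \<and>
      (\<forall>x\<in>cob A. leq (cty A x) (fst p')
        (qcomp Q (cty A x) (fst p) (fst p') q (val p x)) (val p' x))"
    using leq_dist_residual[OF d, of "()" "()"] by (simp add: eq)
qed

lemma presheaf_chom_val:
  assumes "p \<in> presheaves A" "p' \<in> presheaves A" "x \<in> cob A"
  shows "leq (cty A x) (fst p')
    (qcomp Q (cty A x) (fst p) (fst p') (chom (presheaf_cat Q A) p p') (val p x)) (val p' x)"
  using leq_presheaf_chom[OF assms(1,2)] leq_refl[OF arr_presheaf_chom[OF assms(1,2)]] assms(3)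
  by blast

lemma qcategoryI:
  assumes "\<And>x. x \<in> cob A \<Longrightarrow> cty A x \<in> qob Q"
    and "\<And>x y. \<lbrakk>x \<in> cob A; y \<in> cob A\<rbrakk> \<Longrightarrow> arr (cty A x) (cty A y) (chom A x y)"
    and "\<And>x. x \<in> cob A \<Longrightarrow> leq (cty A x) (cty A x) (qid Q (cty A x)) (chom A x x)"
    and "\<And>x y z. \<lbrakk>x \<in> cob A; y \<in> cob A; z \<in> cob A\<rbrakk> \<Longrightarrow> leq (cty A x) (cty A z)
      (qcomp Q (cty A x) (cty A y) (cty A z) (chom A y z) (chom A x y)) (chom A x z)"
  shows "qcategory Q A"
  by unfold_locales (use assms in \<open>auto simp: arr_def intro: leq_imp_le\<close>)

lemma presheaf_qcategory: "qcategory Q (presheaf_cat Q A)"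
proof (rule qcategoryI)
  fix p assume p: "p \<in> presheaves A"
  show "leq (cty (presheaf_cat Q A) p) (cty (presheaf_cat Q A) p)
      (qid Q (cty (presheaf_cat Q A) p)) (chom (presheaf_cat Q A) p p)"
    using presheafD(1,3)[OF p] leq_refl arr_id by (simp add: leq_presheaf_chom[OF p p])
next
  fix p p' p'' assume p: "p \<in> presheaves A" "p' \<in> presheaves A" "p'' \<in> presheaves A"
  note h = arr_presheaf_chom[OF p(1,2)] arr_presheaf_chom[OF p(2,3)]
  show "leq (cty (presheaf_cat Q A) p) (cty (presheaf_cat Q A) p'')
      (qcomp Q (cty (presheaf_cat Q A) p) (cty (presheaf_cat Q A) p') (cty (presheaf_cat Q A) p'')
        (chom (presheaf_cat Q A) p' p'') (chom (presheaf_cat Q A) p p'))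
      (chom (presheaf_cat Q A) p p'')"
    unfolding cty_presheaf_cat leq_presheaf_chom[OF p(1,3)]
  proof (intro conjI ballI arr_comp[OF h])
    fix x assume x: "x \<in> cob A"
    show "leq (cty A x) (fst p'') (qcomp Q (cty A x) (fst p) (fst p'')
        (qcomp Q (fst p) (fst p') (fst p'')
          (chom (presheaf_cat Q A) p' p'') (chom (presheaf_cat Q A) p p')) (val p x)) (val p'' x)"
      unfolding comp_assoc_arr[OF presheafD(3)[OF p(1) x] h]
      by (rule leq_trans[OF comp_mono[OF presheaf_chom_val[OF p(1,2) x] leq_refl[OF h(2)]]
            presheaf_chom_val[OF p(2,3) x]])
  qed
qed (simp_all add: presheafD(1) arr_presheaf_chom)

text \<open>An identity below a hom-arrow of presheaves amounts to inequalities between components,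
  and these are antisymmetric.\<close>

lemma presheaf_skeletal: "qcat_skeletal Q (presheaf_cat Q A)"
proof -
  interpret P: qcategory Q "presheaf_cat Q A" by (rule presheaf_qcategory)
  show ?thesis
    unfolding qcat_skeletal_def
  proof (intro ballI impI)
    fix p p' assume p: "p \<in> presheaves A" "p' \<in> presheaves A"
      and "qcat_le Q (presheaf_cat Q A) p p'" "qcat_le Q (presheaf_cat Q A) p' p"
    then have t: "fst p = fst p'"
      and l: "leq (fst p) (fst p') (qid Q (fst p)) (chom (presheaf_cat Q A) p p')"
        "leq (fst p') (fst p) (qid Q (fst p)) (chom (presheaf_cat Q A) p' p)"
      by (auto simp: P.qcat_le_iff)
    show "p = p'"
    proof (rule presheaf_eqI[OF p t])
      fix x assume x: "x \<in> cob A"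
      show "val p x = val p' x"
        using l[unfolded leq_presheaf_chom[OF p] leq_presheaf_chom[OF p(2,1)]] x t
          presheafD(3)[OF p(1) x] presheafD(3)[OF p(2) x]
        by (intro leq_antisym[of "cty A x" "fst p"]) auto
    qed
  qed
qed

lemma yoneda_in:
  assumes "qcategory Q A" "x \<in> cob A"
  shows "yoneda A x \<in> presheaves A"
  unfolding yoneda_eq
  by (rule mk_presheaf_in[OF assms(1)])
    (use assms qcategory.ty_closed qcategory.arr_chom qcategory.leq_chom_comp in fast)+

lemma yoneda_simps [simp]:
  "fst (yoneda A x) = cty A x" "z \<in> cob A \<Longrightarrow> val (yoneda A x) z = chom A z x"
  by (simp_all add: yoneda_eq)

text \<open>The colimit of the presheaves \<open>p i\<close> with weights \<open>f i\<close>,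
  computed pointwise. The action of \<open>A\<close> passes through the join and is absorbed by the
  factor \<open>val (p i)\<close>.\<close>

lemma weighted_join_in:
  assumes A: "qcategory Q A" and X: "X \<in> qob Q"
    and p: "\<And>i. i \<in> I \<Longrightarrow> p i \<in> presheaves A"
    and f: "\<And>i. i \<in> I \<Longrightarrow> arr (fst (p i)) X (f i)"
  shows "mk_presheaf A X
    (\<lambda>x. join (cty A x) X (\<lambda>i. qcomp Q (cty A x) (fst (p i)) X (f i) (val (p i) x)) I) \<in> presheaves A"
    (is "mk_presheaf A X ?j \<in> _")
proof -
  interpret A: qcategory Q A by fact
  have a: "\<And>i. i \<in> I \<Longrightarrow> arr (cty A x) X (qcomp Q (cty A x) (fst (p i)) X (f i) (val (p i) x))"
    if "x \<in> cob A" for x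
    using arr_comp[OF presheafD(3)[OF p that] f] .
  have up: "leq (cty A x) X (qcomp Q (cty A x) (fst (p i)) X (f i) (val (p i) x)) (?j x)"
    if "x \<in> cob A" "i \<in> I" for x i
    using leq_join[where f="\<lambda>i. qcomp Q (cty A x) (fst (p i)) X (f i) (val (p i) x)",
        OF A.ty_closed[OF that(1)] X a[OF that(1)] that(2)] .
  show ?thesis
  proof (rule mk_presheaf_in[OF A X])
    show arr: "arr (cty A x) X (?j x)" if "x \<in> cob A" for x
      by (rule arr_join[OF A.ty_closed[OF that] X a[OF that]])
    fix x x' assume x: "x \<in> cob A" "x' \<in> cob A"
    show "leq (cty A x') X (qcomp Q (cty A x') (cty A x) X (?j x) (chom A x' x)) (?j x')"
    proof (subst join_comp_iff[OF A.arr_chom[OF x(2,1)] a[OF x(1)] X], assumption,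
        intro conjI ballI arr[OF x(2)])
      fix i assume i: "i \<in> I"
      show "leq (cty A x') X (qcomp Q (cty A x') (cty A x) X
          (qcomp Q (cty A x) (fst (p i)) X (f i) (val (p i) x)) (chom A x' x)) (?j x')"
        unfolding comp_assoc_arr[OF A.arr_chom[OF x(2,1)] presheafD(3)[OF p[OF i] x(1)] f[OF i]]
        by (rule leq_trans[OF comp_mono[OF presheafD(4)[OF p[OF i] x] leq_refl[OF f[OF i]]]
            up[OF x(2) i]])
    qed
  qed
qed

section \<open>Precomposition with a distributor and its right adjoint\<close>

lemma upper_star:
  assumes \<phi>: "qdistributor Q A B \<phi>" and p: "p \<in> presheaves B"
  shows upper_star_in: "dist_upper_star Q A B \<phi> p \<in> presheaves A"
    and fst_upper_star [simp]: "fst (dist_upper_star Q A B \<phi> p) = fst p"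
    and upper_star_leq: "x \<in> cob A \<Longrightarrow>
      leq (cty A x) (fst p) (val (dist_upper_star Q A B \<phi> p) x) h \<longleftrightarrow>
      arr (cty A x) (fst p) h \<and>
      (\<forall>y\<in>cob B. leq (cty A x) (fst p)
        (qcomp Q (cty A x) (cty B y) (fst p) (val p y) (\<phi> x y)) h)"
    and leq_upper_star: "\<lbrakk>x \<in> cob A; y \<in> cob B\<rbrakk> \<Longrightarrow>
      leq (cty A x) (fst p) (qcomp Q (cty A x) (cty B y) (fst p) (val p y) (\<phi> x y))
        (val (dist_upper_star Q A B \<phi> p) x)"
    and comp_upper_star_leq: "\<lbrakk>x \<in> cob A; arr (fst p) Z g\<rbrakk> \<Longrightarrow>
      leq (cty A x) Z (qcomp Q (cty A x) (fst p) Z g (val (dist_upper_star Q A B \<phi> p) x)) h \<longleftrightarrow>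
      arr (cty A x) Z h \<and>
      (\<forall>y\<in>cob B. leq (cty A x) Z (qcomp Q (cty A x) (fst p) Z g
        (qcomp Q (cty A x) (cty B y) (fst p) (val p y) (\<phi> x y))) h)"
proof -
  have eq: "dist_upper_star Q A B \<phi> p = (fst p, dist_comp Q A B (star_cat Q (fst p)) (snd p) \<phi>)"
    by (simp add: dist_upper_star_def split_beta)
  note d = presheafD(2)[OF p]
  show "fst (dist_upper_star Q A B \<phi> p) = fst p" by (simp add: eq)
  show "dist_upper_star Q A B \<phi> p \<in> presheaves A"
    using qdistributor_dist_comp[OF \<phi> d] presheafD(1)[OF p] by (simp add: eq presheaf_iff)
  show "x \<in> cob A \<Longrightarrow> leq (cty A x) (fst p) (val (dist_upper_star Q A B \<phi> p) x) h \<longleftrightarrow>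
      arr (cty A x) (fst p) h \<and>
      (\<forall>y\<in>cob B. leq (cty A x) (fst p)
        (qcomp Q (cty A x) (cty B y) (fst p) (val p y) (\<phi> x y)) h)"
    using dist_comp_leq[OF \<phi> d, of x "()"] by (simp add: eq)
  show "\<lbrakk>x \<in> cob A; y \<in> cob B\<rbrakk> \<Longrightarrow>
      leq (cty A x) (fst p) (qcomp Q (cty A x) (cty B y) (fst p) (val p y) (\<phi> x y))
        (val (dist_upper_star Q A B \<phi> p) x)"
    using leq_dist_comp[OF \<phi> d, of x "()"] by (simp add: eq)
  show "\<lbrakk>x \<in> cob A; arr (fst p) Z g\<rbrakk> \<Longrightarrow>
      leq (cty A x) Z (qcomp Q (cty A x) (fst p) Z g (val (dist_upper_star Q A B \<phi> p) x)) h \<longleftrightarrow>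
      arr (cty A x) Z h \<and>
      (\<forall>y\<in>cob B. leq (cty A x) Z (qcomp Q (cty A x) (fst p) Z g
        (qcomp Q (cty A x) (cty B y) (fst p) (val p y) (\<phi> x y))) h)"
    using comp_dist_comp_leq[OF \<phi> d, of x "()"] by (simp add: eq)
qed

text \<open>The residual of distributors for a one-object codomain; the equivalence for
  \<open>q\<close> is the pointwise form of the adjunction between the two operators.\<close>

lemma lower_star:
  assumes \<phi>: "qdistributor Q A B \<phi>" and p: "p \<in> presheaves A"
  shows lower_star_in: "dist_lower_star Q A B \<phi> p \<in> presheaves B"
    and fst_lower_star [simp]: "fst (dist_lower_star Q A B \<phi> p) = fst p"
    and leq_lower_star: "y \<in> cob B \<Longrightarrow>
      leq (cty B y) (fst p) q (val (dist_lower_star Q A B \<phi> p) y) \<longleftrightarrow>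
      arr (cty B y) (fst p) q \<and>
      (\<forall>x\<in>cob A. leq (cty A x) (fst p) (qcomp Q (cty A x) (cty B y) (fst p) q (\<phi> x y)) (val p x))"
proof -
  have eq: "dist_lower_star Q A B \<phi> p
      = (fst p, dist_residual Q A B (star_cat Q (fst p)) (snd p) \<phi>)"
    by (simp add: dist_lower_star_def split_beta)
  note d = presheafD(2)[OF p]
  show "fst (dist_lower_star Q A B \<phi> p) = fst p" by (simp add: eq)
  show "dist_lower_star Q A B \<phi> p \<in> presheaves B"
    using qdistributor_dist_residual[OF \<phi> d] presheafD(1)[OF p] by (simp add: eq presheaf_iff)
  show "y \<in> cob B \<Longrightarrow>
      leq (cty B y) (fst p) q (val (dist_lower_star Q A B \<phi> p) y) \<longleftrightarrow>
      arr (cty B y) (fst p) q \<and>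
      (\<forall>x\<in>cob A. leq (cty A x) (fst p) (qcomp Q (cty A x) (cty B y) (fst p) q (\<phi> x y)) (val p x))"
    using leq_dist_residual[OF \<phi> d, of y "()"] by (simp add: eq)
qed

end

section \<open>Complete distributivity of \<open>\<K>\<phi>\<close>\<close>

context quantaloid
begin

text \<open>For \<open>K = \<K>\<phi>\<close> the index set is \<open>A\<^sub>0\<close> and \<open>u \<lambda>\<close> is the presheaf \<open>\<phi>\<^sup>*\<lambda>\<close>. The last hypothesis says
  that every \<open>u k\<close> is a weighted join of the \<open>u (a i)\<close>; the totally below distributor is generated
  by the objects \<open>a i\<close>.\<close>

lemma qcat_ccdI:
  assumes K: "qcategory Q K"
    and u: "\<And>k i. \<lbrakk>k \<in> cob K; i \<in> I\<rbrakk> \<Longrightarrow> arr (t i) (cty K k) (u k i)"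
    and hom: "\<And>k k' q. \<lbrakk>k \<in> cob K; k' \<in> cob K\<rbrakk> \<Longrightarrow>
      leq (cty K k) (cty K k') q (chom K k k') \<longleftrightarrow> arr (cty K k) (cty K k') q \<and>
      (\<forall>i\<in>I. leq (t i) (cty K k') (qcomp Q (t i) (cty K k) (cty K k') q (u k i)) (u k' i))"
    and s: "\<And>\<theta>. \<theta> \<in> presheaves K \<Longrightarrow> s \<theta> \<in> cob K \<and> cty K (s \<theta>) = fst \<theta>"
    and u_s: "\<And>\<theta> i. \<lbrakk>\<theta> \<in> presheaves K; i \<in> I\<rbrakk> \<Longrightarrow> u (s \<theta>) i =
      join (t i) (fst \<theta>) (\<lambda>k. qcomp Q (t i) (cty K k) (fst \<theta>) (val \<theta> k) (u k i)) (cob K)"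
    and a: "\<And>i. i \<in> I \<Longrightarrow> a i \<in> cob K \<and> cty K (a i) = t i"
    and u_a: "\<And>k i. \<lbrakk>k \<in> cob K; i \<in> I\<rbrakk> \<Longrightarrow> u k i =
      join (t i) (cty K k) (\<lambda>j. qcomp Q (t i) (t j) (cty K k) (u k j) (u (a j) i)) I"
  shows "qcat_ccd Q K"
proof -
  interpret K: qcategory Q K by fact
  note Y = yoneda_in[OF K]
  have t: "t i \<in> qob Q" if "i \<in> I" for i using a[OF that] K.ty_closed by metis
  have ua: "arr (t i) (t j) (u (a j) i)" if "i \<in> I" "j \<in> I" for i j
    using u[of "a j" i] a[OF that(2)] that by simp
  have sup: "is_qsup Q K s"
    unfolding is_qsup_def
  proof (rule qadjunctionI[OF presheaf_qcategory K])
    fix \<theta> k assume th: "\<theta> \<in> presheaves K" and k: "k \<in> cob K"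
    note s\<theta> = s[OF th]
    \<comment> \<open>Both sides say
      \<open>q \<circ> \<theta>(k') \<circ> u k' i \<le> u k i\<close> for all \<open>k'\<close> and
      \<open>i\<close>, up to bracketing: \<open>u_s\<close> expands the supremum on the left,
      \<open>hom\<close> expands \<open>K(k',k)\<close> on the right.\<close>
    have "leq (fst \<theta>) (cty K k) q (chom K (s \<theta>) k) \<longleftrightarrow>
        leq (fst \<theta>) (cty K k) q (chom (presheaf_cat Q K) \<theta> (yoneda K k))" for q
    proof (cases "arr (fst \<theta>) (cty K k) q")
      case q: True
      have "leq (fst \<theta>) (cty K k) q (chom K (s \<theta>) k) \<longleftrightarrow>
          (\<forall>i\<in>I. \<forall>k'\<in>cob K. leq (t i) (cty K k) (qcomp Q (t i) (fst \<theta>) (cty K k) q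
            (qcomp Q (t i) (cty K k') (fst \<theta>) (val \<theta> k') (u k' i))) (u k i))"
        using hom[of "s \<theta>" k q] s\<theta> k q u u_s[OF th] t arr_comp[OF u presheafD(3)[OF th]]
        by (simp add: comp_join_iff)
      moreover have "leq (fst \<theta>) (cty K k) q (chom (presheaf_cat Q K) \<theta> (yoneda K k)) \<longleftrightarrow>
          (\<forall>k'\<in>cob K. \<forall>i\<in>I. leq (t i) (cty K k) (qcomp Q (t i) (fst \<theta>) (cty K k) q
            (qcomp Q (t i) (cty K k') (fst \<theta>) (val \<theta> k') (u k' i))) (u k i))"
        using leq_presheaf_chom[OF th Y[OF k], of q] q hom[OF _ k]
          comp_assoc_arr[OF u presheafD(3)[OF th] q] arr_comp[OF presheafD(3)[OF th] q]
        by simp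
      ultimately show ?thesis by blast
    qed (use leq_arr in blast)
    then show "chom K (s \<theta>) k = chom (presheaf_cat Q K) \<theta> (yoneda K k)"
      using K.arr_chom[of "s \<theta>" k] s\<theta> k arr_presheaf_chom[OF th Y[OF k]]
      by (intro leq_eqI[of "fst \<theta>" "cty K k"]) simp_all
  qed (use s Y in auto)
  \<comment> \<open>The candidate for the left adjoint of \<open>s\<close>: the join of the
    representables \<open>K(-, a i)\<close> with weights \<open>u k i\<close>.\<close>
  define T where "T k = mk_presheaf K (cty K k) (\<lambda>k'. join (cty K k') (cty K k)
    (\<lambda>i. qcomp Q (cty K k') (t i) (cty K k) (u k i) (chom K k' (a i))) I)" for k
  have T: "T k \<in> presheaves K" if k: "k \<in> cob K" for k
  proof -
    have "T k = mk_presheaf K (cty K k) (\<lambda>k'. join (cty K k') (cty K k)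
        (\<lambda>i. qcomp Q (cty K k') (fst (yoneda K (a i))) (cty K k) (u k i) (val (yoneda K (a i)) k')) I)"
      using a by (auto simp: T_def mk_presheaf_def fun_eq_iff intro!: arg_cong[where f="\<lambda>S. \<Squnion>\<^bsub>_\<^esub> S"] image_cong)
    then show ?thesis
      using weighted_join_in[OF K K.ty_closed[OF k], of I "\<lambda>i. yoneda K (a i)" "u k"] Y a u k by simp
  qed
  \<comment> \<open>\<open>K(a i, k)\<close> is the largest \<open>q\<close> with
    \<open>q \<circ> u (a i) j \<le> u k j\<close> for all \<open>j\<close>. The arrow
    \<open>u k i\<close> qualifies since \<open>u k i \<circ> u (a i) j\<close> is a member of the
    join for \<open>u k j\<close> in \<open>u_a\<close>.\<close>
  have u_le: "leq (t i) (cty K k) (u k i) (chom K (a i) k)" if k: "k \<in> cob K" and i: "i \<in> I" for k i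
  proof -
    have "leq (t j) (cty K k) (qcomp Q (t j) (t i) (cty K k) (u k i) (u (a i) j)) (u k j)"
      if j: "j \<in> I" for j
      by (subst u_a[OF k j], rule leq_join[where
          f="\<lambda>i. qcomp Q (t j) (t i) (cty K k) (u k i) (u (a i) j)", OF t[OF j] K.ty_closed[OF k]])
        (use arr_comp ua u k i j in blast)+
    then show ?thesis using hom[of "a i" k "u k i"] a[OF i] k u[OF k i] by simp
  qed
  have "qadjunction Q K (presheaf_cat Q K) T s"
  proof (rule qadjunctionI[OF K presheaf_qcategory])
    fix k \<theta> assume k: "k \<in> cob K" and th: "\<theta> \<in> presheaves K"
    note s\<theta> = s[OF th]
    have Ka: "arr (cty K k') (t i) (chom K k' (a i))" if "k' \<in> cob K" "i \<in> I" for k' i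
      using K.arr_chom[OF that(1), of "a i"] a[OF that(2)] by simp
    have "leq (cty K k) (fst \<theta>) q (chom (presheaf_cat Q K) (T k) \<theta>) \<longleftrightarrow>
        leq (cty K k) (fst \<theta>) q (chom K k (s \<theta>))" for q
    proof (cases "arr (cty K k) (fst \<theta>) q")
      case q: True
      have 1: "leq (cty K k) (fst \<theta>) q (chom (presheaf_cat Q K) (T k) \<theta>) \<longleftrightarrow>
          (\<forall>k'\<in>cob K. \<forall>i\<in>I. leq (cty K k') (fst \<theta>) (qcomp Q (cty K k') (cty K k) (fst \<theta>) q
            (qcomp Q (cty K k') (t i) (cty K k) (u k i) (chom K k' (a i)))) (val \<theta> k'))"
        using leq_presheaf_chom[OF T[OF k] th, of q] q presheafD(3)[OF th] K.ty_closed
          arr_comp[OF Ka u[OF k]]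
        by (simp add: T_def comp_join_iff)
      have 2: "leq (cty K k) (fst \<theta>) q (chom K k (s \<theta>)) \<longleftrightarrow>
          (\<forall>i\<in>I. leq (t i) (fst \<theta>) (qcomp Q (t i) (cty K k) (fst \<theta>) q (u k i)) (u (s \<theta>) i))"
        using hom[of k "s \<theta>" q] s\<theta> k q by simp
      \<comment> \<open>Yoneda lemma: testing on the representable \<open>K(-, a i)\<close> amounts
        to testing at \<open>k' = a i\<close> on the identity; conversely, the action on
        \<open>\<theta>\<close> spreads the value at \<open>a i\<close> to every
        \<open>k'\<close>.\<close>
      have 3: "leq (cty K k) (fst \<theta>) q (chom (presheaf_cat Q K) (T k) \<theta>) \<longleftrightarrow>
          (\<forall>i\<in>I. leq (t i) (fst \<theta>) (qcomp Q (t i) (cty K k) (fst \<theta>) q (u k i)) (val \<theta> (a i)))"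
        unfolding 1
      proof (intro iffI ballI)
        fix i assume i: "i \<in> I" and *: "\<forall>k'\<in>cob K. \<forall>i\<in>I. leq (cty K k') (fst \<theta>)
          (qcomp Q (cty K k') (cty K k) (fst \<theta>) q
            (qcomp Q (cty K k') (t i) (cty K k) (u k i) (chom K k' (a i)))) (val \<theta> k')"
        note ai = conjunct1[OF a[OF i]] conjunct2[OF a[OF i]]
        have "leq (t i) (cty K k) (u k i) (qcomp Q (t i) (t i) (cty K k) (u k i) (chom K (a i) (a i)))"
          using comp_mono[OF K.leq_chom_id[OF ai(1)], unfolded ai(2), OF leq_refl[OF u[OF k i]]]
            u[OF k i] by simp
        from leq_trans[OF comp_mono[OF this leq_refl[OF q]]]
        show "leq (t i) (fst \<theta>) (qcomp Q (t i) (cty K k) (fst \<theta>) q (u k i)) (val \<theta> (a i))"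
          using *[rule_format, OF ai(1) i] ai(2) by simp
      next
        fix k' i assume i: "i \<in> I" and k': "k' \<in> cob K" and *: "\<forall>i\<in>I. leq (t i) (fst \<theta>)
          (qcomp Q (t i) (cty K k) (fst \<theta>) q (u k i)) (val \<theta> (a i))"
        note ai = conjunct1[OF a[OF i]] conjunct2[OF a[OF i]]
        show "leq (cty K k') (fst \<theta>) (qcomp Q (cty K k') (cty K k) (fst \<theta>) q
            (qcomp Q (cty K k') (t i) (cty K k) (u k i) (chom K k' (a i)))) (val \<theta> k')"
          unfolding comp_assoc_arr[OF Ka[OF k' i] u[OF k i] q, symmetric]
          by (rule leq_trans[OF comp_mono[OF leq_refl[OF Ka[OF k' i]] *[rule_format, OF i]]
              presheafD(4)[OF th ai(1) k', unfolded ai(2)]])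
      qed
      have \<theta>a: "arr (t i) (fst \<theta>) (val \<theta> (a i))" if "i \<in> I" for i
        using presheafD(3)[OF th, of "a i"] a[OF that] by simp
      have c: "arr (t i) (fst \<theta>) (qcomp Q (t i) (cty K k') (fst \<theta>) (val \<theta> k') (u k' i))"
        if "k' \<in> cob K" "i \<in> I" for k' i
        using arr_comp[OF u presheafD(3)[OF th]] that by blast
      have us: "leq (t i) (fst \<theta>) (qcomp Q (t i) (cty K k') (fst \<theta>) (val \<theta> k') (u k' i)) (u (s \<theta>) i)"
        if k': "k' \<in> cob K" and i: "i \<in> I" for k' i
        by (subst u_s[OF th i], rule leq_join[where
            f="\<lambda>k'. qcomp Q (t i) (cty K k') (fst \<theta>) (val \<theta> k') (u k' i)",
            OF t[OF i] presheafD(1)[OF th] c[OF _ i] k'])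
      show ?thesis
        \<comment> \<open>Here \<open>q \<circ> u k i\<close> is bounded by
          \<open>\<theta>(a i)\<close> on one side and by \<open>u (s \<theta>) i\<close> on the
          other. From the first bound to the second, \<open>u k i\<close> is expanded by
          \<open>u_a\<close>, and \<open>\<theta>(a j) \<circ> u (a j) i\<close> is a member of the
          join for \<open>u (s \<theta>) i\<close>. The way back is
          \<open>u (s \<theta>) i \<le> \<theta>(a i)\<close>, which follows from
          \<open>u_le\<close>.\<close>
        unfolding 2 3
      proof (intro iffI ballI)
        fix i assume i: "i \<in> I" and *: "\<forall>i\<in>I. leq (t i) (fst \<theta>)
          (qcomp Q (t i) (cty K k) (fst \<theta>) q (u k i)) (val \<theta> (a i))"
        have uu: "\<And>j. j \<in> I \<Longrightarrow> arr (t i) (cty K k) (qcomp Q (t i) (t j) (cty K k) (u k j) (u (a j) i))"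
          using arr_comp ua u k i by blast
        show "leq (t i) (fst \<theta>) (qcomp Q (t i) (cty K k) (fst \<theta>) q (u k i)) (u (s \<theta>) i)"
        proof (subst u_a[OF k i], subst comp_join_iff[OF uu q t[OF i]], assumption,
            intro conjI ballI)
          show "arr (t i) (fst \<theta>) (u (s \<theta>) i)" using u[of "s \<theta>" i] s\<theta> i by simp
          fix j assume j: "j \<in> I"
          note aj = conjunct1[OF a[OF j]] conjunct2[OF a[OF j]]
          show "leq (t i) (fst \<theta>) (qcomp Q (t i) (cty K k) (fst \<theta>) q
              (qcomp Q (t i) (t j) (cty K k) (u k j) (u (a j) i))) (u (s \<theta>) i)"
            unfolding comp_assoc_arr[OF ua[OF i j] u[OF k j] q, symmetric]
            by (rule leq_trans[OF comp_mono[OF leq_refl[OF ua[OF i j]] *[rule_format, OF j]]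
                us[OF aj(1) i, unfolded aj(2)]])
        qed
      next
        fix i assume i: "i \<in> I" and *: "\<forall>i\<in>I. leq (t i) (fst \<theta>)
          (qcomp Q (t i) (cty K k) (fst \<theta>) q (u k i)) (u (s \<theta>) i)"
        note ai = conjunct1[OF a[OF i]] conjunct2[OF a[OF i]]
        have "leq (t i) (fst \<theta>) (u (s \<theta>) i) (val \<theta> (a i))"
        proof (subst u_s[OF th i], subst join_iff(1)[OF t[OF i] presheafD(1)[OF th] c[OF _ i]],
            assumption, intro conjI ballI \<theta>a[OF i])
          fix k' assume k': "k' \<in> cob K"
          show "leq (t i) (fst \<theta>) (qcomp Q (t i) (cty K k') (fst \<theta>) (val \<theta> k') (u k' i)) (val \<theta> (a i))"
            by (rule leq_trans[OF comp_mono[OF u_le[OF k' i] leq_refl[OF presheafD(3)[OF th k']]]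
                presheafD(4)[OF th k' ai(1), unfolded ai(2)]])
        qed
        with * i show "leq (t i) (fst \<theta>) (qcomp Q (t i) (cty K k) (fst \<theta>) q (u k i)) (val \<theta> (a i))"
          using leq_trans by blast
      qed
    qed (use leq_arr in blast)
    then show "chom (presheaf_cat Q K) (T k) \<theta> = chom K k (s \<theta>)"
      using K.arr_chom[of k "s \<theta>"] s\<theta> k arr_presheaf_chom[OF T[OF k] th]
      by (intro leq_eqI[of "cty K k" "fst \<theta>"]) (simp_all add: T_def)
  qed (use T s in \<open>auto simp: T_def\<close>)
  with sup show ?thesis by (auto simp: qcat_ccd_def qcat_complete_def)
qed

section \<open>The fixed points of the closure operator of a distributor\<close>

lemma kan_cat_simps [simp]:
  "p \<in> cob (kan_cat Q A B \<phi>) \<longleftrightarrow>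
    p \<in> presheaves B \<and> dist_lower_star Q A B \<phi> (dist_upper_star Q A B \<phi> p) = p"
  "cty (kan_cat Q A B \<phi>) p = fst p"
  "chom (kan_cat Q A B \<phi>) = chom (presheaf_cat Q B)"
  by (simp_all add: kan_cat_def)

lemma kan_qcategory: "qcategory Q (kan_cat Q A B \<phi>)"
proof -
  interpret P: qcategory Q "presheaf_cat Q B" by (rule presheaf_qcategory)
  show ?thesis
    using P.ty_closed P.arr_chom P.leq_chom_id P.leq_chom_comp by (intro qcategoryI) simp_all
qed

text \<open>The triangle identity: passing from \<open>p\<close> to its closure does not change
  \<open>dist_upper_star\<close>, so closing up twice is the same as once and every closure is a
  fixed point.\<close>

lemma kan_closure:
  assumes \<phi>: "qdistributor Q A B \<phi>" and p: "p \<in> presheaves B"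
  defines "k \<equiv> dist_lower_star Q A B \<phi> (dist_upper_star Q A B \<phi> p)"
  shows upper_star_closure: "dist_upper_star Q A B \<phi> k = dist_upper_star Q A B \<phi> p"
    and closure_in_kan: "k \<in> cob (kan_cat Q A B \<phi>)"
    and fst_closure: "fst k = fst p"
proof -
  note up = upper_star_in[OF \<phi> p]
  have k: "k \<in> presheaves B" unfolding k_def by (rule lower_star_in[OF \<phi> up])
  show fst: "fst k = fst p" by (simp add: k_def fst_lower_star[OF \<phi> up] fst_upper_star[OF \<phi> p])
  have leq_k: "leq (cty B y) (fst p) q (val k y) \<longleftrightarrow> arr (cty B y) (fst p) q \<and>
      (\<forall>x\<in>cob A. leq (cty A x) (fst p) (qcomp Q (cty A x) (cty B y) (fst p) q (\<phi> x y))
        (val (dist_upper_star Q A B \<phi> p) x))" if "y \<in> cob B" for y q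
    using leq_lower_star[OF \<phi> up that] by (simp add: k_def fst_upper_star[OF \<phi> p])
  show eq: "dist_upper_star Q A B \<phi> k = dist_upper_star Q A B \<phi> p"
  proof (rule presheaf_eqI[OF upper_star_in[OF \<phi> k] up])
    show "fst (dist_upper_star Q A B \<phi> k) = fst (dist_upper_star Q A B \<phi> p)"
      by (simp add: fst_upper_star[OF \<phi> k] fst_upper_star[OF \<phi> p] fst)
    fix x assume x: "x \<in> cob A"
    have ak: "arr (cty B y) (fst p) (val k y)" if "y \<in> cob B" for y
      using presheafD(3)[OF k that] fst by simp
    have upx: "arr (cty A x) (fst p) (val (dist_upper_star Q A B \<phi> p) x)"
      "arr (cty A x) (fst p) (val (dist_upper_star Q A B \<phi> k) x)"
      using presheafD(3)[OF up x] presheafD(3)[OF upper_star_in[OF \<phi> k] x] fst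
      by (simp_all add: fst_upper_star[OF \<phi> p] fst_upper_star[OF \<phi> k])
    show "val (dist_upper_star Q A B \<phi> k) x = val (dist_upper_star Q A B \<phi> p) x"
    proof (rule leq_antisym)
      show "leq (cty A x) (fst p) (val (dist_upper_star Q A B \<phi> k) x)
          (val (dist_upper_star Q A B \<phi> p) x)"
        unfolding upper_star_leq[OF \<phi> k x, unfolded fst]
        using leq_k leq_refl[OF ak] x upx by blast
      have "leq (cty B y) (fst p) (val p y) (val k y)" if "y \<in> cob B" for y
        unfolding leq_k[OF that] using leq_upper_star[OF \<phi> p _ that] presheafD(3)[OF p that] by blast
      then show "leq (cty A x) (fst p) (val (dist_upper_star Q A B \<phi> p) x)
          (val (dist_upper_star Q A B \<phi> k) x)"
        unfolding upper_star_leq[OF \<phi> p x]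
        using leq_upper_star[OF \<phi> k x, unfolded fst] upx
          comp_mono[OF leq_refl[OF qdistributorD(3)[OF \<phi> x]]] leq_trans by blast
    qed
  qed
  then show "k \<in> cob (kan_cat Q A B \<phi>)" using k by (simp add: k_def)
qed

text \<open>Associativity of composition of distributors, read for presheaves.\<close>

lemma upper_star_upper_star:
  assumes "qdistributor Q A B \<phi>" "qdistributor Q D A \<epsilon>" "p \<in> presheaves B"
  shows "dist_upper_star Q D A \<epsilon> (dist_upper_star Q A B \<phi> p)
    = dist_upper_star Q D B (dist_comp Q D A B \<phi> \<epsilon>) p"
  using dist_comp_assoc[OF assms(2,1) presheafD(2)[OF assms(3)]]
  by (simp add: dist_upper_star_def split_beta)

text \<open>An instance of \<open>qcat_ccdI\<close>, indexed by the objects of \<open>A\<close>,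
  with \<open>u p\<close> the presheaf \<open>?up p\<close>. Suprema are formed among all presheaves
  on \<open>B\<close> and then closed up; the generating objects are the closures of the columns of
  \<open>\<psi>\<close>.\<close>

lemma kan_ccd:
  assumes "regular_distributor Q A B \<phi>"
  shows "qcat_ccd Q (kan_cat Q A B \<phi>)"
proof -
  from assms obtain \<psi> where \<phi>: "qdistributor Q A B \<phi>" and \<psi>: "qdistributor Q B A \<psi>"
    and reg: "dist_comp Q A A B \<phi> (dist_comp Q A B A \<psi> \<phi>) = \<phi>"
    by (auto simp: regular_distributor_def)
  let ?K = "kan_cat Q A B \<phi>"
  let ?up = "dist_upper_star Q A B \<phi>"
  let ?low = "dist_lower_star Q A B \<phi>"
  define e where "e = dist_comp Q A B A \<psi> \<phi>"
  have e: "qdistributor Q A A e" unfolding e_def by (rule qdistributor_dist_comp[OF \<phi> \<psi>])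
  interpret A: qcategory Q A by (rule qdistributorD(1)[OF \<phi>])
  note B = qdistributorD(2)[OF \<phi>]
  interpret B: qcategory Q B by (rule B)
  have up: "?up p \<in> presheaves A" "fst (?up p) = fst p" if "p \<in> presheaves B" for p
    using upper_star_in[OF \<phi> that] fst_upper_star[OF \<phi> that] by auto
  \<comment> \<open>The supremum of \<open>\<theta>\<close> among all presheaves on
    \<open>B\<close>; its closure under \<open>?low\<close> and \<open>?up\<close> is the supremum
    among the fixed points.\<close>
  define \<sigma> where "\<sigma> \<theta> = mk_presheaf B (fst \<theta>) (\<lambda>y. join (cty B y) (fst \<theta>)
    (\<lambda>k. qcomp Q (cty B y) (fst k) (fst \<theta>) (val \<theta> k) (val k y)) (cob ?K))" for \<theta>
  have \<sigma>: "\<sigma> \<theta> \<in> presheaves B" if th: "\<theta> \<in> presheaves ?K" for \<theta>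
    unfolding \<sigma>_def
    by (rule weighted_join_in[OF B presheafD(1)[OF th]]) (use presheafD(3)[OF th] in auto)
  \<comment> \<open>The column \<open>\<psi>(-,x)\<close>, chosen because \<open>?up\<close> sends
    it to \<open>(\<psi> \<circ> \<phi>)(-,x) = e(-,x)\<close>.\<close>
  define \<beta> where "\<beta> x = mk_presheaf B (cty A x) (\<lambda>y. \<psi> y x)" for x
  have \<beta>: "\<beta> x \<in> presheaves B" if x: "x \<in> cob A" for x
    unfolding \<beta>_def by (rule mk_presheaf_in[OF B A.ty_closed[OF x]])
      (use x qdistributorD[OF \<psi>] in blast)+
  show ?thesis
  proof (rule qcat_ccdI[where K="?K" and I="cob A" and t="cty A" and u="\<lambda>p. val (?up p)"
        and s="\<lambda>\<theta>. ?low (?up (\<sigma> \<theta>))" and a="\<lambda>x. ?low (?up (\<beta> x))"])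
    show "qcategory Q ?K" by (rule kan_qcategory)
  next
    fix p x assume "p \<in> cob ?K" "x \<in> cob A"
    then show "arr (cty A x) (cty ?K p) (val (?up p) x)"
      using presheafD(3)[OF up(1), of p x] up(2) by simp
  next
    fix p p' q assume "p \<in> cob ?K" "p' \<in> cob ?K"
    then have p: "p \<in> presheaves B" "p' \<in> presheaves B" and fix_p': "?low (?up p') = p'" by auto
    \<comment> \<open>Since \<open>p'\<close> is a fixed point it may be written as
      \<open>?low (?up p')\<close>; transposing along the adjunction moves the test from
      \<open>B\<close> to \<open>A\<close>.\<close>
    have "leq (fst p) (fst p') q (chom (presheaf_cat Q B) p p') \<longleftrightarrow>
      (\<forall>x\<in>cob A. leq (cty A x) (fst p') (qcomp Q (cty A x) (fst p) (fst p') q (val (?up p) x))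
        (val (?up p') x))" if q: "arr (fst p) (fst p') q"
    proof -
      have "leq (fst p) (fst p') q (chom (presheaf_cat Q B) p p') \<longleftrightarrow>
        (\<forall>y\<in>cob B. leq (cty B y) (fst p') (qcomp Q (cty B y) (fst p) (fst p') q (val p y))
          (val (?low (?up p')) y))"
        using leq_presheaf_chom[OF p] q fix_p' by simp
      also have "\<dots> \<longleftrightarrow> (\<forall>y\<in>cob B. \<forall>x\<in>cob A. leq (cty A x) (fst p')
        (qcomp Q (cty A x) (fst p) (fst p') q (qcomp Q (cty A x) (cty B y) (fst p) (val p y) (\<phi> x y)))
        (val (?up p') x))"
      proof (intro ball_cong refl)
        fix y assume y: "y \<in> cob B"
        show "leq (cty B y) (fst p') (qcomp Q (cty B y) (fst p) (fst p') q (val p y))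
            (val (?low (?up p')) y) \<longleftrightarrow> (\<forall>x\<in>cob A. leq (cty A x) (fst p')
          (qcomp Q (cty A x) (fst p) (fst p') q (qcomp Q (cty A x) (cty B y) (fst p) (val p y) (\<phi> x y)))
          (val (?up p') x))"
          using leq_lower_star[OF \<phi> up(1)[OF p(2)] y] up(2)[OF p(2)]
            arr_comp[OF presheafD(3)[OF p(1) y] q]
            comp_assoc_arr[OF qdistributorD(3)[OF \<phi> _ y] presheafD(3)[OF p(1) y] q] by simp
      qed
      also have "\<dots> \<longleftrightarrow> (\<forall>x\<in>cob A. leq (cty A x) (fst p')
        (qcomp Q (cty A x) (fst p) (fst p') q (val (?up p) x)) (val (?up p') x))"
        using comp_upper_star_leq[OF \<phi> p(1) _ q] presheafD(3)[OF up(1)[OF p(2)]] up(2)[OF p(2)]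
        by auto
      finally show ?thesis .
    qed
    then show "leq (cty ?K p) (cty ?K p') q (chom ?K p p') \<longleftrightarrow> arr (cty ?K p) (cty ?K p') q \<and>
      (\<forall>x\<in>cob A. leq (cty A x) (cty ?K p') (qcomp Q (cty A x) (cty ?K p) (cty ?K p') q
        (val (?up p) x)) (val (?up p') x))"
      using leq_arr by auto
  next
    fix \<theta> assume "\<theta> \<in> presheaves ?K"
    then show "?low (?up (\<sigma> \<theta>)) \<in> cob ?K \<and> cty ?K (?low (?up (\<sigma> \<theta>))) = fst \<theta>"
      using closure_in_kan[OF \<phi> \<sigma>, of \<theta>] fst_closure[OF \<phi> \<sigma>, of \<theta>]
      unfolding kan_cat_simps(2) by (simp only: \<sigma>_def mk_presheaf_simps)
  next
    fix \<theta> x assume th: "\<theta> \<in> presheaves ?K" and x: "x \<in> cob A"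
    note d\<phi> = qdistributorD(3)[OF \<phi> x]
    have \<theta>: "arr (fst k) (fst \<theta>) (val \<theta> k)" "k \<in> presheaves B" if "k \<in> cob ?K" for k
      using presheafD(3)[OF th that] that by auto
    have [simp]: "fst (\<sigma> \<theta>) = fst \<theta>" by (simp add: \<sigma>_def)
    note ob = A.ty_closed[OF x] presheafD(1)[OF th]
    have c: "arr (cty A x) (fst \<theta>) (qcomp Q (cty A x) (fst k) (fst \<theta>) (val \<theta> k) (val (?up k) x))"
      if "k \<in> cob ?K" for k
      using arr_comp[OF presheafD(3)[OF up(1)[OF \<theta>(2)[OF that]] x], unfolded up(2)[OF \<theta>(2)[OF that]],
          OF \<theta>(1)[OF that]] .
    have "val (?up (\<sigma> \<theta>)) x = join (cty A x) (fst \<theta>)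
      (\<lambda>k. qcomp Q (cty A x) (fst k) (fst \<theta>) (val \<theta> k) (val (?up k) x)) (cob ?K)"
    \<comment> \<open>Precomposition with \<open>\<phi>\<close> preserves weighted joins. Comparing
      upper bounds turns the interchange of the joins over \<open>y\<close> and \<open>k\<close>
      into an exchange of quantifiers.\<close>
    proof (rule leq_eqI_upper[of "cty A x" "fst \<theta>"])
      fix h
      show "leq (cty A x) (fst \<theta>) (val (?up (\<sigma> \<theta>)) x) h \<longleftrightarrow> leq (cty A x) (fst \<theta>)
        (join (cty A x) (fst \<theta>)
          (\<lambda>k. qcomp Q (cty A x) (fst k) (fst \<theta>) (val \<theta> k) (val (?up k) x)) (cob ?K)) h"
      proof (cases "arr (cty A x) (fst \<theta>) h")
        case h: True
        have "leq (cty A x) (fst \<theta>) (val (?up (\<sigma> \<theta>)) x) h \<longleftrightarrow>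
          (\<forall>y\<in>cob B. leq (cty A x) (fst \<theta>) (qcomp Q (cty A x) (cty B y) (fst \<theta>)
            (join (cty B y) (fst \<theta>)
              (\<lambda>k. qcomp Q (cty B y) (fst k) (fst \<theta>) (val \<theta> k) (val k y)) (cob ?K)) (\<phi> x y)) h)"
          using upper_star_leq[OF \<phi> \<sigma>[OF th] x, of h] h by (simp add: \<sigma>_def)
        also have "\<dots> \<longleftrightarrow> (\<forall>y\<in>cob B. \<forall>k\<in>cob ?K. leq (cty A x) (fst \<theta>)
          (qcomp Q (cty A x) (fst k) (fst \<theta>) (val \<theta> k)
            (qcomp Q (cty A x) (cty B y) (fst k) (val k y) (\<phi> x y))) h)"
        proof (intro ball_cong refl)
          fix y assume y: "y \<in> cob B"
          have "\<And>k. k \<in> cob ?K \<Longrightarrow>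
              arr (cty B y) (fst \<theta>) (qcomp Q (cty B y) (fst k) (fst \<theta>) (val \<theta> k) (val k y))"
            using arr_comp[OF presheafD(3)[OF \<theta>(2) y] \<theta>(1)] by blast
          from join_comp_iff[OF d\<phi>[OF y] this presheafD(1)[OF th], of "cob ?K" "\<lambda>k. k" h]
          show "leq (cty A x) (fst \<theta>) (qcomp Q (cty A x) (cty B y) (fst \<theta>)
            (join (cty B y) (fst \<theta>)
              (\<lambda>k. qcomp Q (cty B y) (fst k) (fst \<theta>) (val \<theta> k) (val k y)) (cob ?K)) (\<phi> x y)) h \<longleftrightarrow>
            (\<forall>k\<in>cob ?K. leq (cty A x) (fst \<theta>) (qcomp Q (cty A x) (fst k) (fst \<theta>) (val \<theta> k)
              (qcomp Q (cty A x) (cty B y) (fst k) (val k y) (\<phi> x y))) h)"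
            using h comp_assoc_arr[OF d\<phi>[OF y] presheafD(3)[OF \<theta>(2) y] \<theta>(1)] by simp
        qed
        also have "\<dots> \<longleftrightarrow> (\<forall>k\<in>cob ?K. leq (cty A x) (fst \<theta>)
          (qcomp Q (cty A x) (fst k) (fst \<theta>) (val \<theta> k) (val (?up k) x)) h)"
          using comp_upper_star_leq[OF \<phi> \<theta>(2) x \<theta>(1)] h by blast
        also have "\<dots> \<longleftrightarrow> leq (cty A x) (fst \<theta>) (join (cty A x) (fst \<theta>)
          (\<lambda>k. qcomp Q (cty A x) (fst k) (fst \<theta>) (val \<theta> k) (val (?up k) x)) (cob ?K)) h"
          by (subst join_iff(1)[OF ob c]) (use h in auto)
        finally show ?thesis .
      qed (use leq_arr in blast)
    next
      show "arr (cty A x) (fst \<theta>) (val (?up (\<sigma> \<theta>)) x)"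
        using presheafD(3)[OF up(1)[OF \<sigma>[OF th]] x] up(2)[OF \<sigma>[OF th]] by simp
    qed (rule arr_join[OF ob c])
    then show "val (?up (?low (?up (\<sigma> \<theta>)))) x = join (cty A x) (fst \<theta>)
      (\<lambda>k. qcomp Q (cty A x) (cty ?K k) (fst \<theta>) (val \<theta> k) (val (?up k) x)) (cob ?K)"
      unfolding upper_star_closure[OF \<phi> \<sigma>[OF th]] by simp
  next
    fix x assume x: "x \<in> cob A"
    then show "?low (?up (\<beta> x)) \<in> cob ?K \<and> cty ?K (?low (?up (\<beta> x))) = cty A x"
      using closure_in_kan[OF \<phi> \<beta>[OF x]] fst_closure[OF \<phi> \<beta>[OF x]]
      unfolding kan_cat_simps(2) by (simp only: \<beta>_def mk_presheaf_simps)
  next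
    fix p x assume "p \<in> cob ?K" and x: "x \<in> cob A"
    then have p: "p \<in> presheaves B" by simp
    have up_\<beta>: "val (?up (?low (?up (\<beta> x')))) x = e x x'" if "x' \<in> cob A" for x'
      unfolding upper_star_closure[OF \<phi> \<beta>[OF that]]
      using that x by (auto simp: e_def dist_upper_star_def dist_comp_def \<beta>_def mk_presheaf_def
          intro!: arg_cong[where f="\<lambda>S. \<Squnion>\<^bsub>_\<^esub> S"] image_cong)
    \<comment> \<open>Regularity enters here: \<open>\<phi> \<circ> e = \<phi>\<close>, so the
      presheaf \<open>?up p\<close> is invariant under \<open>e\<close> and is thus a weighted join
      of the columns of \<open>e\<close>.\<close>
    have "?up p = dist_upper_star Q A A e (?up p)"
      using upper_star_upper_star[OF \<phi> e p] reg by (simp add: e_def)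
    then have "val (?up p) x = val (dist_upper_star Q A A e (?up p)) x" by simp
    also have "\<dots> = join (cty A x) (fst p)
      (\<lambda>x'. qcomp Q (cty A x) (cty A x') (fst p) (val (?up p) x') (e x x')) (cob A)"
      using x up(2)[OF p] by (simp add: dist_upper_star_def[of Q A A] split_beta dist_comp_apply)
    also have "\<dots> = join (cty A x) (fst p)
      (\<lambda>x'. qcomp Q (cty A x) (cty A x') (fst p) (val (?up p) x') (val (?up (?low (?up (\<beta> x')))) x))
      (cob A)"
      by (intro arg_cong[where f="\<lambda>S. \<Squnion>\<^bsub>_\<^esub> S"] image_cong refl) (simp only: up_\<beta>)
    finally show "val (?up p) x = join (cty A x) (cty ?K p)
      (\<lambda>x'. qcomp Q (cty A x) (cty A x') (cty ?K p) (val (?up p) x')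
        (val (?up (?low (?up (\<beta> x')))) x)) (cob A)"
      by simp
  qed
qed

end

section \<open>The totally below distributor\<close>

context quantaloid
begin

context
  fixes C :: "('c, 'o, 'm) qcategory" and S :: "('c, 'o, 'm) presheaf \<Rightarrow> 'c"
    and T :: "'c \<Rightarrow> ('c, 'o, 'm) presheaf"
  assumes C: "qcategory Q C" and skel: "qcat_skeletal Q C"
    and S_Y: "is_qsup Q C S" and T_S: "qadjunction Q C (presheaf_cat Q C) T S"
begin

interpretation C: qcategory Q C by (rule C)

definition totally_below :: "'c \<Rightarrow> 'c \<Rightarrow> 'm" where
  "totally_below x y = (if x \<in> cob C \<and> y \<in> cob C then val (T y) x else undefined)"

lemma sup_in: "p \<in> presheaves C \<Longrightarrow> S p \<in> cob C \<and> cty C (S p) = fst p"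
  using S_Y by (simp add: is_qsup_def qadjunction_def qfunctor_def)

lemma below_in: "x \<in> cob C \<Longrightarrow> T x \<in> presheaves C \<and> fst (T x) = cty C x"
  using T_S by (simp add: qadjunction_def qfunctor_def)

lemma chom_sup:
  "\<lbrakk>p \<in> presheaves C; x \<in> cob C\<rbrakk> \<Longrightarrow> chom C (S p) x = chom (presheaf_cat Q C) p (yoneda C x)"
  using qadjunction_chom[OF presheaf_qcategory C S_Y[unfolded is_qsup_def]] .

lemma chom_below:
  "\<lbrakk>x \<in> cob C; p \<in> presheaves C\<rbrakk> \<Longrightarrow> chom (presheaf_cat Q C) (T x) p = chom C x (S p)"
  using qadjunction_chom[OF C presheaf_qcategory T_S] .

text \<open>The Yoneda embedding is fully faithful, so \<open>S (yoneda C x)\<close> and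
  \<open>x\<close> have the same hom-arrows into every \<open>z\<close>; skeletality identifies
  them.\<close>

lemma sup_yoneda: "x \<in> cob C \<Longrightarrow> S (yoneda C x) = x"
proof (rule C.skeletal_eqI[OF skel])
  fix x z assume x: "x \<in> cob C" and z: "z \<in> cob C"
  note Y = yoneda_in[OF C]
  show "chom C (S (yoneda C x)) z = chom C x z"
    unfolding chom_sup[OF Y[OF x] z]
  proof (rule leq_antisym[of "cty C x" "cty C z"])
    show "leq (cty C x) (cty C z) (chom (presheaf_cat Q C) (yoneda C x) (yoneda C z)) (chom C x z)"
      using leq_trans[OF comp_mono[OF C.leq_chom_id[OF x] leq_refl[OF arr_presheaf_chom[OF Y[OF x] Y[OF z]],
            unfolded yoneda_simps]]]
        presheaf_chom_val[OF Y[OF x] Y[OF z] x] arr_presheaf_chom[OF Y[OF x] Y[OF z]] x by simp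
    show "leq (cty C x) (cty C z) (chom C x z) (chom (presheaf_cat Q C) (yoneda C x) (yoneda C z))"
      using leq_presheaf_chom[OF Y[OF x] Y[OF z], of "chom C x z"] C.arr_chom C.leq_chom_comp x z
      by simp
  qed
qed (use sup_in yoneda_in[OF C] in auto)

text \<open>Full faithfulness passes from the right end of the adjoint string to the left:
  \<open>C(STx,x) = PC(Tx,Yx) = C(x,SYx) = C(x,x)\<close>. Hence the unit \<open>x \<le> STx\<close>
  has a converse, and skeletality gives equality.\<close>

lemma sup_below:
  assumes x: "x \<in> cob C"
  shows "S (T x) = x"
proof -
  interpret P: qcategory Q "presheaf_cat Q C" by (rule presheaf_qcategory)
  note Tx = conjunct1[OF below_in[OF x]] conjunct2[OF below_in[OF x]] and Yx = yoneda_in[OF C x]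
  note STx = conjunct1[OF sup_in[OF Tx(1)]] conjunct2[OF sup_in[OF Tx(1)]]
  have "qcat_le Q C x (S (T x))" using T_S x by (simp add: qadjunction_def)
  moreover have "chom C (S (T x)) x = chom C x x"
    using chom_sup[OF Tx(1) x] chom_below[OF x Yx] sup_yoneda[OF x] by simp
  then have "qcat_le Q C (S (T x)) x"
    using C.leq_chom_id[OF x] STx Tx(2) x by (simp add: C.qcat_le_iff)
  ultimately show ?thesis using skel STx(1) x by (simp add: qcat_skeletal_def)
qed

text \<open>The action in the first variable holds since each \<open>T y\<close> is a presheaf, the
  one in the second since \<open>T\<close> is a functor.\<close>

lemma totally_below: "qdistributor Q C C totally_below"
proof (rule qdistributorI[OF C C])
  fix x y assume xy: "x \<in> cob C" "y \<in> cob C"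
  show "arr (cty C x) (cty C y) (totally_below x y)"
    using presheafD(3)[of "T y" C x] below_in[OF xy(2)] xy by (simp add: totally_below_def)
next
  fix x x' y assume xy: "x \<in> cob C" "x' \<in> cob C" "y \<in> cob C"
  show "leq (cty C x') (cty C y)
      (qcomp Q (cty C x') (cty C x) (cty C y) (totally_below x y) (chom C x' x)) (totally_below x' y)"
    using presheafD(4)[of "T y" C x x'] below_in[OF xy(3)] xy by (simp add: totally_below_def)
next
  fix x y y' assume xy: "x \<in> cob C" "y \<in> cob C" "y' \<in> cob C"
  note Ty = conjunct1[OF below_in[OF xy(2)]] conjunct2[OF below_in[OF xy(2)]]
    and Ty' = conjunct1[OF below_in[OF xy(3)]] conjunct2[OF below_in[OF xy(3)]]
  have T: "qfunctor Q C (presheaf_cat Q C) T" using T_S by (simp add: qadjunction_def)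
  show "leq (cty C x) (cty C y')
      (qcomp Q (cty C x) (cty C y) (cty C y') (chom C y y') (totally_below x y)) (totally_below x y')"
    using leq_presheaf_chom[OF Ty(1) Ty'(1), of "chom C y y'"]
      qfunctorD(3)[OF C presheaf_qcategory T xy(2,3)] Ty(2) Ty'(2) xy
    by (simp add: totally_below_def)
qed (auto simp: totally_below_def)

section \<open>The operators induced by the totally below distributor\<close>

text \<open>Transposed along the adjunction of \<open>T\<close> and \<open>S\<close>, the hom-arrow
  \<open>C(y, S p)\<close> becomes that from \<open>T y\<close> to \<open>p\<close>, which is the
  residual of \<open>p\<close> along \<open>totally_below\<close> at \<open>y\<close>.\<close>

lemma leq_chom_sup:
  assumes p: "p \<in> presheaves C" and y: "y \<in> cob C"
  shows "leq (cty C y) (fst p) q (chom C y (S p)) \<longleftrightarrow> arr (cty C y) (fst p) q \<and>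
    (\<forall>x\<in>cob C. leq (cty C x) (fst p)
      (qcomp Q (cty C x) (cty C y) (fst p) q (totally_below x y)) (val p x))"
  using leq_presheaf_chom[OF conjunct1[OF below_in[OF y]] p, of q] below_in[OF y] y
  by (simp add: totally_below_def chom_below[OF y p, symmetric])

lemma lower_star_totally_below:
  assumes p: "p \<in> presheaves C"
  shows "dist_lower_star Q C C totally_below p = yoneda C (S p)"
proof (rule presheaf_eqI[OF lower_star_in[OF totally_below p] yoneda_in[OF C]])
  note Sp = conjunct1[OF sup_in[OF p]] conjunct2[OF sup_in[OF p]]
  note low = lower_star_in[OF totally_below p] fst_lower_star[OF totally_below p]
  show "S p \<in> cob C" by (rule Sp)
  show "fst (dist_lower_star Q C C totally_below p) = fst (yoneda C (S p))" using low Sp by simp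
  fix y assume y: "y \<in> cob C"
  show "val (dist_lower_star Q C C totally_below p) y = val (yoneda C (S p)) y"
  proof (rule leq_eqI[of "cty C y" "fst p"])
    show "leq (cty C y) (fst p) q (val (dist_lower_star Q C C totally_below p) y) \<longleftrightarrow>
        leq (cty C y) (fst p) q (val (yoneda C (S p)) y)" for q
      using leq_lower_star[OF totally_below p y] leq_chom_sup[OF p y] y by simp
  qed (use presheafD(3)[OF low(1) y] low(2) C.arr_chom[OF y Sp(1)] Sp(2) y in simp_all)
qed

text \<open>\<open>T S p\<close> and \<open>\<theta>\<^sup>* p\<close> have the same hom-arrows into every presheaf \<open>\<nu>\<close>: both are
  \<open>\<P>C(p, Y S \<nu>)\<close>.\<close>

lemma upper_star_totally_below:
  assumes p: "p \<in> presheaves C"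
  shows "dist_upper_star Q C C totally_below p = T (S p)"
proof -
  interpret P: qcategory Q "presheaf_cat Q C" by (rule presheaf_qcategory)
  note Sp = conjunct1[OF sup_in[OF p]] conjunct2[OF sup_in[OF p]]
  note TSp = conjunct1[OF below_in[OF Sp(1)]] conjunct2[OF below_in[OF Sp(1)]]
  note up = upper_star_in[OF totally_below p] fst_upper_star[OF totally_below p]
  show ?thesis
  proof (rule P.skeletal_eqI[OF presheaf_skeletal up(1) TSp(1)])
    show "cty (presheaf_cat Q C) (dist_upper_star Q C C totally_below p)
        = cty (presheaf_cat Q C) (T (S p))"
      using up TSp Sp by simp
    fix \<nu> assume \<nu>: "\<nu> \<in> presheaves C"
    note S\<nu> = conjunct1[OF sup_in[OF \<nu>]] conjunct2[OF sup_in[OF \<nu>]]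
    note YS\<nu> = yoneda_in[OF C S\<nu>(1)]
    have "chom (presheaf_cat Q C) (dist_upper_star Q C C totally_below p) \<nu>
        = chom (presheaf_cat Q C) p (yoneda C (S \<nu>))"
    proof (rule leq_eqI[of "fst p" "fst \<nu>"])
      show "arr (fst p) (fst \<nu>)
          (chom (presheaf_cat Q C) (dist_upper_star Q C C totally_below p) \<nu>)"
        using arr_presheaf_chom[OF up(1) \<nu>] up(2) by simp
      show "arr (fst p) (fst \<nu>) (chom (presheaf_cat Q C) p (yoneda C (S \<nu>)))"
        using arr_presheaf_chom[OF p YS\<nu>] S\<nu>(2) by simp
      fix q
      show "leq (fst p) (fst \<nu>) q
          (chom (presheaf_cat Q C) (dist_upper_star Q C C totally_below p) \<nu>) \<longleftrightarrow>
        leq (fst p) (fst \<nu>) q (chom (presheaf_cat Q C) p (yoneda C (S \<nu>)))"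
      proof (cases "arr (fst p) (fst \<nu>) q")
        case q: True
        have "leq (fst p) (fst \<nu>) q
            (chom (presheaf_cat Q C) (dist_upper_star Q C C totally_below p) \<nu>) \<longleftrightarrow>
          (\<forall>x\<in>cob C. \<forall>y\<in>cob C. leq (cty C x) (fst \<nu>) (qcomp Q (cty C x) (fst p) (fst \<nu>) q
            (qcomp Q (cty C x) (cty C y) (fst p) (val p y) (totally_below x y))) (val \<nu> x))"
          using leq_presheaf_chom[OF up(1) \<nu>, of q, unfolded up(2)] q
            comp_upper_star_leq[OF totally_below p _ q] presheafD(3)[OF \<nu>] by auto
        \<comment> \<open>The bound of \<open>q \<circ> p(y)\<close> by \<open>C(y, S \<nu>)\<close>
          is unfolded by \<open>leq_chom_sup\<close>, which leads to the same family of inequalities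
          with the quantifiers exchanged.\<close>
        moreover have "leq (fst p) (fst \<nu>) q (chom (presheaf_cat Q C) p (yoneda C (S \<nu>))) \<longleftrightarrow>
          (\<forall>y\<in>cob C. \<forall>x\<in>cob C. leq (cty C x) (fst \<nu>) (qcomp Q (cty C x) (fst p) (fst \<nu>) q
            (qcomp Q (cty C x) (cty C y) (fst p) (val p y) (totally_below x y))) (val \<nu> x))"
          using leq_presheaf_chom[OF p YS\<nu>, of q] q S\<nu>(2) leq_chom_sup[OF \<nu>]
            arr_comp[OF presheafD(3)[OF p] q]
            comp_assoc_arr[OF qdistributorD(3)[OF totally_below] presheafD(3)[OF p] q] by simp
        ultimately show ?thesis by blast
      qed (use leq_arr in blast)
    qed
    also have "\<dots> = chom (presheaf_cat Q C) (T (S p)) \<nu>"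
      by (simp only: chom_sup[OF p S\<nu>(1), symmetric] chom_below[OF Sp(1) \<nu>])
    finally show "chom (presheaf_cat Q C) (dist_upper_star Q C C totally_below p) \<nu>
      = chom (presheaf_cat Q C) (T (S p)) \<nu>" .
  qed
qed

text \<open>Column \<open>z\<close> of the composite is \<open>dist_upper_star\<close> applied to
  \<open>T z\<close>, that is \<open>T (S (T z)) = T z\<close>.\<close>

lemma totally_below_idem: "dist_comp Q C C C totally_below totally_below = totally_below"
proof (intro ext)
  fix x z
  show "dist_comp Q C C C totally_below totally_below x z = totally_below x z"
  proof (cases "x \<in> cob C \<and> z \<in> cob C")
    case True
    note Tz = below_in[OF conjunct2[OF True]]
    have "dist_comp Q C C C totally_below totally_below x z
        = val (dist_upper_star Q C C totally_below (T z)) x"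
      using True Tz by (auto simp: dist_upper_star_def split_beta dist_comp_def totally_below_def
          intro!: arg_cong[where f="\<lambda>S. \<Squnion>\<^bsub>_\<^esub> S"] image_cong)
    then show ?thesis
      using upper_star_totally_below[of "T z"] Tz sup_below True by (simp add: totally_below_def)
  qed (auto simp: dist_comp_def totally_below_def)
qed

text \<open>An idempotent is regular with itself as the witness.\<close>

lemma totally_below_regular: "regular_distributor Q C C totally_below"
  using totally_below totally_below_idem by (auto simp: regular_distributor_def)

text \<open>The closure of \<open>p\<close> is \<open>Y S T S p = Y S p\<close>, so the fixed points
  are the presheaves with \<open>Y S p = p\<close>. On these \<open>Y\<close> inverts
  \<open>S\<close>, while \<open>S Y = 1\<close> holds on \<open>C\<close>.\<close>

lemma iso_kan_totally_below: "qcat_iso Q C (kan_cat Q C C totally_below)"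
proof -
  have closure: "dist_lower_star Q C C totally_below (dist_upper_star Q C C totally_below p)
      = yoneda C (S p)" if "p \<in> presheaves C" for p
    using that sup_in below_in sup_below
    by (simp add: upper_star_totally_below lower_star_totally_below)
  have kan: "p \<in> cob (kan_cat Q C C totally_below) \<longleftrightarrow> p \<in> presheaves C \<and> yoneda C (S p) = p" for p
    using closure[of p] by auto
  have Y: "qfunctor Q C (presheaf_cat Q C) (yoneda C)" and S: "qfunctor Q (presheaf_cat Q C) C S"
    using S_Y by (auto simp: is_qsup_def qadjunction_def)
  have "qfunctor Q C (kan_cat Q C C totally_below) (yoneda C)"
    using qfunctorD(3)[OF C presheaf_qcategory Y] yoneda_in[OF C] sup_yoneda
    by (intro qfunctorI) (simp_all add: kan del: kan_cat_simps(1))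
  moreover have "qfunctor Q (kan_cat Q C C totally_below) C S"
    using qfunctorD(3)[OF presheaf_qcategory C S] sup_in
    by (intro qfunctorI) (simp_all add: kan del: kan_cat_simps(1))
  ultimately show ?thesis
    unfolding qcat_iso_def using sup_yoneda kan by blast
qed

end

end

theorem theorem4p5:
  fixes Q :: "('o, 'm) quantaloid"
  assumes "quantaloid Q"
  shows "(\<forall>(A :: ('x, 'o, 'm) qcategory) (B :: ('y, 'o, 'm) qcategory) \<phi>.
            regular_distributor Q A B \<phi> \<longrightarrow>
              qcategory Q (kan_cat Q A B \<phi>) \<and> qcat_ccd Q (kan_cat Q A B \<phi>)) \<and>
         (\<forall>C :: ('c, 'o, 'm) qcategory.
            qcategory Q C \<and> qcat_skeletal Q C \<and> qcat_ccd Q C \<longrightarrow>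
              (\<exists>(A :: ('c, 'o, 'm) qcategory) (B :: ('c, 'o, 'm) qcategory) \<phi>.
                 regular_distributor Q A B \<phi> \<and> qcat_iso Q C (kan_cat Q A B \<phi>)))"
proof -
  interpret quantaloid Q by fact
  show ?thesis
    \<comment> \<open>For the converse both \<open>A\<close> and \<open>B\<close> are
      \<open>C\<close> itself, and the distributor is \<open>totally_below\<close> for an adjoint
      string supplied by \<open>qcat_ccd\<close>.\<close>
    using kan_qcategory kan_ccd totally_below_regular iso_kan_totally_below
    unfolding qcat_ccd_def by blast
qed

end
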